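(* For the rotating Kepler problem the flag curvature can become negative: with angular velocity $a=1$, there exist an energy parameter $c>\frac32$, a point $(x,y)$ with $x>0$, and a nonzero tangent vector $(u,v)$ at that point with $v\neq 0$, such that the flag curvature $K$ of the Finsler metric $F$ Legendre dual to $F^*_{c,1}$ satisfies $K(x,y,u,v)<0$.
   Context: Polar coordinates $(x,y)$ on the $p$-plane ($p_1=x\cos y$, $p_2=x\sin y$), with cotangent fiber coordinates $(r,t)$ defined by $r\,dx+t\,dy=q_1dp_1+q_2dp_2$ and tangent fiber coordinates $(u,v)$. The Cartan fundamental function of the rotating Kepler problem (angular velocity $1$, energy $-c$, $c>3/2$) is $$F^*_{c,1}(x,y,r,t)=\frac14(x^2+2c)\sqrt{r^2+\tfrac{t^2}{x^2}}\left(1+\sqrt{1-\frac{16\,t}{\sqrt{r^2+\frac{t^2}{x^2}}\,(x^2+2c)^2}}\right),$$ which is fiberwise strictly convex and positively $1$-homogeneous. Let $\mathcal{L}^*=\frac12(F^*_{c,1})^2$, let $\mathcal{L}(x,y,u,v)=\frac12F^2$ be its fiberwise Legendre transform ($u=\mathcal{L}^*_r$, $v=\mathcal{L}^*_t$), so $F$ is a Finsler metric. Let $D=\mathcal{L}_{uu}\mathcal{L}_{vv}-\mathcal{L}_{uv}^2$ and define spray coefficients $$2G=\tfrac{1}{D}\big(\mathcal{L}_{vv}\mathcal{L}_x-\mathcal{L}_{vx}\mathcal{L}_v-\mathcal{L}_{uv}\mathcal{L}_y+\mathcal{L}_{uy}\mathcal{L}_v\big),\quad 2H=\tfrac{1}{D}\big(\mathcal{L}_{uu}\mathcal{L}_y-\mathcal{L}_{uy}\mathcal{L}_u-\mathcal{L}_{vu}\mathcal{L}_x+\mathcal{L}_{vx}\mathcal{L}_u\big).$$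 The flag curvature (a function on the slit tangent bundle of the surface; subscripts are partial derivatives in the independent variables $x,y,u,v$) is, where $v\neq0$, $$K=\frac{(G_{xv}-G_{yu})\,v+2GG_{uu}+2HG_{uv}-G_uG_u-G_vH_u}{v\,\mathcal{L}_v}.$$ *)

theory Defs
  imports "HOL-Analysis.Analysis"
begin

text \<open>Functions of the four coordinates (x, y, fiber1, fiber2) on the (co)tangent bundle
  of the polar-coordinate chart.\<close>
type_synonym rf4 = "real \<Rightarrow> real \<Rightarrow> real \<Rightarrow> real \<Rightarrow> real"

definition D1 :: "rf4 \<Rightarrow> rf4" where
  "D1 f = (\<lambda>x y u v. deriv (\<lambda>s. f s y u v) x)"
definition D2 :: "rf4 \<Rightarrow> rf4" where
  "D2 f = (\<lambda>x y u v. deriv (\<lambda>s. f x s u v) y)"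
definition D3 :: "rf4 \<Rightarrow> rf4" where
  "D3 f = (\<lambda>x y u v. deriv (\<lambda>s. f x y s v) u)"
definition D4 :: "rf4 \<Rightarrow> rf4" where
  "D4 f = (\<lambda>x y u v. deriv (\<lambda>s. f x y u s) v)"

text \<open>Cartan fundamental function of the rotating Kepler problem, angular velocity 1,
  energy -c; arguments x y r t.\<close>
definition Fstar :: "real \<Rightarrow> rf4" where
  "Fstar c = (\<lambda>x y r t.
     1/4 * (x\<^sup>2 + 2*c) * sqrt (r\<^sup>2 + t\<^sup>2 / x\<^sup>2) *
     (1 + sqrt (1 - 16 * t / (sqrt (r\<^sup>2 + t\<^sup>2 / x\<^sup>2) * (x\<^sup>2 + 2*c)\<^sup>2))))"

definition Lstar :: "real \<Rightarrow> rf4" where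
  "Lstar c = (\<lambda>x y r t. (Fstar c x y r t)\<^sup>2 / 2)"

definition Lleg :: "real \<Rightarrow> rf4" where
  "Lleg c = (\<lambda>x y u v.
     (let p = (THE p. D3 (Lstar c) x y (fst p) (snd p) = u \<and> D4 (Lstar c) x y (fst p) (snd p) = v)
      in fst p * u + snd p * v - Lstar c x y (fst p) (snd p)))"

definition detL :: "real \<Rightarrow> rf4" where
  "detL c = (\<lambda>x y u v. D3 (D3 (Lleg c)) x y u v * D4 (D4 (Lleg c)) x y u v
                       - (D4 (D3 (Lleg c)) x y u v)\<^sup>2)"

text \<open>Spray coefficients G and H (the displayed formulas give 2G and 2H).\<close>
definition sprayG :: "real \<Rightarrow> rf4" where
  "sprayG c = (\<lambda>x y u v. let L = Lleg c in
     (1 / detL c x y u v) *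
       (D4 (D4 L) x y u v * D1 L x y u v - D1 (D4 L) x y u v * D4 L x y u v
        - D4 (D3 L) x y u v * D2 L x y u v + D2 (D3 L) x y u v * D4 L x y u v) / 2)"

definition sprayH :: "real \<Rightarrow> rf4" where
  "sprayH c = (\<lambda>x y u v. let L = Lleg c in
     (1 / detL c x y u v) *
       (D3 (D3 L) x y u v * D2 L x y u v - D2 (D3 L) x y u v * D3 L x y u v
        - D3 (D4 L) x y u v * D1 L x y u v + D1 (D4 L) x y u v * D3 L x y u v) / 2)"

text \<open>Flag curvature (valid where v \<noteq> 0).\<close>
definition flagK :: "real \<Rightarrow> rf4" where
  "flagK c = (\<lambda>x y u v. let G = sprayG c; H = sprayH c; L = Lleg c in
     ((D4 (D1 G) x y u v - D3 (D2 G) x y u v) * v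
      + 2 * G x y u v * D3 (D3 G) x y u v + 2 * H x y u v * D4 (D3 G) x y u v
      - D3 G x y u v * D3 G x y u v - D4 G x y u v * D3 H x y u v)
     / (v * D4 L x y u v))"

end

theory Submission
  imports Defs
begin

text \<open>
  With \<open>A = x\<^sup>2 + 2c\<close> and \<open>\<rho>\<close> the norm of \<open>(r, t/x)\<close>, the Cartan function is
  \<open>(A \<rho> + R) / 4\<close> where \<open>R\<^sup>2 = A\<^sup>2 \<rho>\<^sup>2 - 16 t \<rho>\<close>. Both summands are convex, so the gradient of
  \<open>Lstar\<close> is injective on the fibre, and the definite description in \<open>Lleg\<close> is legitimate.
  For \<open>t > 0\<close> put \<open>w = A Fstar / t\<close>. Then \<open>\<rho>\<close>, \<open>r\<^sup>2/t\<^sup>2\<close>, \<open>u/r\<close>, \<open>v/t\<close> and hence also \<open>u\<^sup>2/v\<^sup>2\<close> are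
  rational functions of \<open>(x, w)\<close> up to powers of \<open>t\<close>. Solving \<open>u\<^sup>2/v\<^sup>2 = Yf c x w\<close> for \<open>w\<close> is
  the only implicit step; all derivatives of \<open>Lleg\<close> and both spray coefficients become rational in
  \<open>(x, w, u, v)\<close>. On \<open>u = 0\<close> the curvature needs only first derivatives of \<open>G/v\<^sup>2\<close>. At \<open>c = 61/40\<close>,
  \<open>x = 1/2\<close>, where \<open>A\<^sup>2 - 16 x\<close> is the square of a rational, it equals \<open>-1364375/334084\<close>.
\<close>

section \<open>Injectivity of the Legendre map\<close>

text \<open>The gradient inequality for the convex function \<open>sqrt (\<rho>\<^sup>2 - e \<rho> \<tau>)\<close> of \<open>(r, \<tau>)\<close> at unit vectors.\<close>

lemma unit_vectors_convexity:
  fixes a b p q e :: real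
  assumes ab: "a\<^sup>2 + b\<^sup>2 = 1" and pq: "p\<^sup>2 + q\<^sup>2 = 1" and e: "0 \<le> e" "e \<le> 1"
  defines "C \<equiv> a * p + b * q"
  shows "C - e * (b * C + q) / 2 \<le> sqrt ((1 - e * b) * (1 - e * q))"
proof (cases "C - e * (b * C + q) / 2 \<le> 0")
  case True
  have "b\<^sup>2 \<le> 1" "q\<^sup>2 \<le> 1" using ab pq by (smt (verit) zero_le_power2)+
  then have "\<bar>b\<bar> \<le> 1" "\<bar>q\<bar> \<le> 1" by (simp_all add: abs_square_le_1)
  then have "e * b \<le> 1" "e * q \<le> 1"
    using e by (smt (verit) mult_left_le mult_nonneg_nonpos)+
  then have "0 \<le> (1 - e * b) * (1 - e * q)" by simp
  then show ?thesis using True by (meson order_trans real_sqrt_ge_zero)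
next
  case False
  define B where "B = 2 - e * b"
  have b: "b\<^sup>2 \<le> 1" "q\<^sup>2 \<le> 1" using ab pq by (smt (verit) zero_le_power2)+
  then have b1: "\<bar>b\<bar> \<le> 1" and q1: "\<bar>q\<bar> \<le> 1" by (simp_all add: abs_square_le_1)
  \<comment> \<open>Lagrange's identity for the two unit vectors: \<open>C\<close> is the cosine of
    their angle, and the left side is the square of the sine.\<close>
  have "(a * q - b * p)\<^sup>2 = (a\<^sup>2 + b\<^sup>2) * (p\<^sup>2 + q\<^sup>2) - C\<^sup>2"
    unfolding C_def by algebra
  then have S: "(a * q - b * p)\<^sup>2 = 1 - C\<^sup>2" using ab pq by simp
  then have C2: "C\<^sup>2 \<le> 1" by (smt (verit) zero_le_power2)
  then have C1: "\<bar>C\<bar> \<le> 1" by (simp add: abs_square_le_1)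
  have "q - b * C = q * (1 - b\<^sup>2) - a * b * p" unfolding C_def by algebra
  also have "\<dots> = a * (a * q - b * p)" using ab by algebra
  finally have qb: "(q - b * C)\<^sup>2 = (1 - b\<^sup>2) * (1 - C\<^sup>2)"
    using S ab by (metis add_diff_cancel_right' power_mult_distrib)
  \<comment> \<open>Eliminating \<open>q^2\<close> through \<open>qb\<close> makes the difference of
    the two squared sides divisible by \<open>1 - C\<close>; \<open>M\<close> is the cofactor, so
    only its sign remains to be settled.\<close>
  define M where "M = (1 + C) * (B\<^sup>2 - e\<^sup>2) / 4 - e * q * (B - 1)"
  have id: "(1 - e * b) * (1 - e * q) - (C - e * (b * C + q) / 2)\<^sup>2 = (1 - C) * M"
    unfolding M_def B_def using qb by algebra
  have eb: "e * b \<le> e" using e b1 by (simp add: mult_left_le abs_le_iff)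
  have B1: "1 \<le> B" and Be: "e \<le> B" unfolding B_def using eb e by linarith+
  have Be2: "0 \<le> B\<^sup>2 - e\<^sup>2" using Be e by (simp add: power_mono)
  have "0 \<le> M"
  proof (cases "q \<le> 0")
    case True
    then have "e * q * (B - 1) \<le> 0" using e B1 by (simp add: mult_nonneg_nonpos mult_nonpos_nonneg)
    moreover have "0 \<le> (1 + C) * (B\<^sup>2 - e\<^sup>2)" using C1 Be2 by simp
    ultimately show ?thesis unfolding M_def by linarith
  next
    case q: False
    \<comment> \<open>The assumption that the left side of the goal is positive says exactly
      \<open>e * q < C * B\<close>. Inserting this lower bound for \<open>C * B\<close> into
      \<open>B * M\<close> removes \<open>C\<close>.\<close>
    have "e * q \<le> C * B" using False unfolding B_def by (simp add: algebra_simps)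
    then have "(B + e * q) * (B\<^sup>2 - e\<^sup>2) \<le> (B + C * B) * (B\<^sup>2 - e\<^sup>2)"
      using Be2 by (intro mult_right_mono) auto
    then have "(B + e * q) * (B\<^sup>2 - e\<^sup>2) - 4 * (e * q) * B * (B - 1)
        \<le> (B + C * B) * (B\<^sup>2 - e\<^sup>2) - 4 * (e * q) * B * (B - 1)"
      by simp
    moreover have "4 * (B * M) = (B + C * B) * (B\<^sup>2 - e\<^sup>2) - 4 * (e * q) * B * (B - 1)"
      unfolding M_def by (simp add: algebra_simps diff_divide_distrib add_divide_distrib)
    \<comment> \<open>The bound is affine in \<open>q\<close>, so it is the interpolation of its
      values at \<open>q = 0\<close> and \<open>q = 1\<close>, both nonnegative because
      \<open>0 \<le> e \<le> B\<close> and \<open>e \<le> 1\<close>.\<close>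
    moreover have "(B + e * q) * (B\<^sup>2 - e\<^sup>2) - 4 * (e * q) * B * (B - 1)
        = (1 - q) * (B * (B\<^sup>2 - e\<^sup>2)) + q * ((B - e) * (B - e)\<^sup>2 + 4 * B * e * (1 - e))"
      by algebra
    moreover have "0 \<le> (1 - q) * (B * (B\<^sup>2 - e\<^sup>2))" using q1 B1 Be2 by simp
    moreover have "0 \<le> q * ((B - e) * (B - e)\<^sup>2 + 4 * B * e * (1 - e))" using q e B1 Be by simp
    ultimately have "0 \<le> B * M" by linarith
    then show ?thesis using B1 by (simp add: zero_le_mult_iff)
  qed
  then have "0 \<le> (1 - C) * M" using C1 by simp
  then have "(C - e * (b * C + q) / 2)\<^sup>2 \<le> (1 - e * b) * (1 - e * q)" using id by linarith
  then show ?thesis by (rule real_le_rsqrt)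
qed

section \<open>Gradient, convexity and homogeneity of the Cartan function\<close>

definition rho :: "real \<Rightarrow> real \<Rightarrow> real \<Rightarrow> real" where
  "rho x r t = sqrt (r\<^sup>2 + t\<^sup>2 / x\<^sup>2)"

definition rad :: "real \<Rightarrow> real \<Rightarrow> real \<Rightarrow> real \<Rightarrow> real" where
  "rad c x r t = sqrt (((x\<^sup>2 + 2*c) * rho x r t)\<^sup>2 - 16 * t * rho x r t)"

definition Fstar_r :: "real \<Rightarrow> real \<Rightarrow> real \<Rightarrow> real \<Rightarrow> real" where
  "Fstar_r c x r t = ((x\<^sup>2 + 2*c) * r / rho x r t
     + ((x\<^sup>2 + 2*c)\<^sup>2 * r - 8 * t * r / rho x r t) / rad c x r t) / 4"

definition Fstar_t :: "real \<Rightarrow> real \<Rightarrow> real \<Rightarrow> real \<Rightarrow> real" where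
  "Fstar_t c x r t = ((x\<^sup>2 + 2*c) * t / (x\<^sup>2 * rho x r t)
     + ((x\<^sup>2 + 2*c)\<^sup>2 * t / x\<^sup>2 - 8 * rho x r t - 8 * t\<^sup>2 / (x\<^sup>2 * rho x r t)) / rad c x r t) / 4"

text \<open>At \<open>c = 3/2\<close> the difference of the two sides has a double zero at
  \<open>x = 1\<close> and a positive cofactor, so any larger energy parameter makes it strictly
  positive. Together with \<open>t \<le> x * \<rho>\<close> this keeps the inner root of
  \<open>Fstar\<close> away from zero.\<close>

lemma energy_bound:
  fixes c x :: real
  assumes "c > 3/2"
  shows "16 * x < (x\<^sup>2 + 2*c)\<^sup>2"
proof -
  have "(x\<^sup>2 + 3)\<^sup>2 - 16 * x = (x - 1)\<^sup>2 * ((x + 1)\<^sup>2 + 8)" by algebra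
  then have "16 * x \<le> (x\<^sup>2 + 3)\<^sup>2" by (smt (verit) zero_le_mult_iff zero_le_power2)
  also have "\<dots> < (x\<^sup>2 + 2*c)\<^sup>2" using assms by (intro power_strict_mono) (auto simp: add_pos_nonneg)
  finally show ?thesis .
qed

lemma rho_pos: "x > 0 \<Longrightarrow> (r, t) \<noteq> (0, 0) \<Longrightarrow> rho x r t > 0"
  by (auto simp: rho_def add_pos_nonneg add_nonneg_pos)

lemma rho_nonneg: "0 \<le> rho x r t"
  by (simp add: rho_def)

lemma rho_square: "(rho x r t)\<^sup>2 = r\<^sup>2 + t\<^sup>2 / x\<^sup>2"
  by (simp add: rho_def)

lemma le_rho: "x > 0 \<Longrightarrow> t \<le> x * rho x r t"
proof -
  assume "x > 0"
  have "t / x \<le> rho x r t" unfolding rho_def by (rule real_le_rsqrt) (simp add: power_divide)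
  then show ?thesis using \<open>x > 0\<close> by (simp add: field_simps)
qed

lemma radicand_pos:
  assumes "c > 3/2" "x > 0" "(r, t) \<noteq> (0, 0)"
  shows "((x\<^sup>2 + 2*c) * rho x r t)\<^sup>2 - 16 * t * rho x r t > 0"
proof -
  have p: "rho x r t > 0" using assms by (simp add: rho_pos)
  have "16 * t \<le> 16 * x * rho x r t" using le_rho[OF assms(2), of t r] by simp
  also have "\<dots> < (x\<^sup>2 + 2*c)\<^sup>2 * rho x r t"
    using energy_bound[OF assms(1), of x] p by (simp add: mult_strict_right_mono)
  finally have "16 * t * rho x r t < (x\<^sup>2 + 2*c)\<^sup>2 * rho x r t * rho x r t"
    using p by (rule mult_strict_right_mono)
  then show ?thesis by (simp add: power2_eq_square algebra_simps)
qed

text \<open>Moving the factor \<open>A * \<rho>\<close> under the inner root removes the quotient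
  inside it. At the zero covector both sides vanish.\<close>

lemma Fstar_eq:
  assumes "c > 3/2"
  shows "Fstar c x y r t = ((x\<^sup>2 + 2*c) * rho x r t + rad c x r t) / 4"
proof (cases "rho x r t = 0")
  case True
  then show ?thesis by (simp add: Fstar_def rad_def flip: rho_def)
next
  case False
  define A where "A = x\<^sup>2 + 2*c"
  define p where "p = rho x r t"
  have A: "A > 0" unfolding A_def using assms by (simp add: add_nonneg_pos)
  have p: "p > 0" using False rho_nonneg[of x r t] by (simp add: p_def)
  have "rad c x r t = sqrt ((A * p)\<^sup>2 * (1 - 16 * t / (p * A\<^sup>2)))"
    unfolding rad_def A_def[symmetric] p_def[symmetric]
    using A p by (intro arg_cong[where f = sqrt]) (simp add: field_simps power2_eq_square)
  also have "\<dots> = A * p * sqrt (1 - 16 * t / (p * A\<^sup>2))"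
    using A p by (simp add: real_sqrt_mult)
  finally show ?thesis
    unfolding Fstar_def A_def[symmetric] rho_def[symmetric] p_def[symmetric]
    by (simp add: algebra_simps)
qed

lemma Fstar_pos:
  assumes "c > 3/2" "x > 0" "(r, t) \<noteq> (0, 0)"
  shows "Fstar c x y r t > 0"
  using rho_pos[OF assms(2,3)] radicand_pos[OF assms] assms
  by (simp add: Fstar_eq rad_def add_pos_pos)

lemma Lstar_has_derivative_r:
  assumes "c > 3/2" "x > 0" "(r, t) \<noteq> (0, 0)"
  shows "((\<lambda>s. Lstar c x y s t) has_real_derivative Fstar c x y r t * Fstar_r c x r t) (at r)"
proof -
  have p: "r\<^sup>2 + t\<^sup>2 / x\<^sup>2 > 0" using rho_pos[OF assms(2,3)] by (simp add: rho_def)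
  have rho: "((\<lambda>s. rho x s t) has_real_derivative r / rho x r t) (at r)"
    unfolding rho_def using p by (auto intro!: derivative_eq_intros simp: field_simps)
  have rad: "((\<lambda>s. rad c x s t) has_real_derivative
      ((x\<^sup>2 + 2*c)\<^sup>2 * r - 8 * t * r / rho x r t) / rad c x r t) (at r)"
    unfolding rad_def
    using radicand_pos[OF assms] rho_pos[OF assms(2,3)]
    by (auto intro!: derivative_eq_intros rho simp: field_simps power2_eq_square)
  show ?thesis
    unfolding Lstar_def Fstar_eq[OF assms(1)] Fstar_r_def
    by (rule derivative_eq_intros rho rad refl | simp)+
qed

lemma Lstar_has_derivative_t:
  assumes "c > 3/2" "x > 0" "(r, t) \<noteq> (0, 0)"
  shows "((\<lambda>s. Lstar c x y r s) has_real_derivative Fstar c x y r t * Fstar_t c x r t) (at t)"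
proof -
  have p: "r\<^sup>2 + t\<^sup>2 / x\<^sup>2 > 0" using rho_pos[OF assms(2,3)] by (simp add: rho_def)
  have rho: "((\<lambda>s. rho x r s) has_real_derivative t / (x\<^sup>2 * rho x r t)) (at t)"
    unfolding rho_def using p assms by (auto intro!: derivative_eq_intros simp: field_simps)
  have rad: "((\<lambda>s. rad c x r s) has_real_derivative
      ((x\<^sup>2 + 2*c)\<^sup>2 * t / x\<^sup>2 - 8 * rho x r t - 8 * t\<^sup>2 / (x\<^sup>2 * rho x r t)) / rad c x r t) (at t)"
    unfolding rad_def
    using radicand_pos[OF assms] rho_pos[OF assms(2,3)] assms(2)
    by (auto intro!: derivative_eq_intros rho simp: field_simps power2_eq_square)
  show ?thesis
    unfolding Lstar_def Fstar_eq[OF assms(1)] Fstar_t_def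
    by (rule derivative_eq_intros rho rad refl | simp)+
qed

text \<open>The support inequality of a convex 1-homogeneous function, proved separately for the two
  summands \<open>A \<rho>\<close> and \<open>R\<close>: Cauchy-Schwarz handles the first and
  \<open>unit_vectors_convexity\<close> the second. Equality in the sum forces equality in
  Cauchy-Schwarz, hence covectors in the same direction.\<close>

lemma Fstar_gradient_ineq:
  assumes c: "c > 3/2" and x: "x > 0" and p1: "(r1, t1) \<noteq> (0, 0)" and p2: "(r2, t2) \<noteq> (0, 0)"
  shows "Fstar_r c x r1 t1 * r2 + Fstar_t c x r1 t1 * t2 \<le> Fstar c x y r2 t2"
    and "Fstar_r c x r1 t1 * r2 + Fstar_t c x r1 t1 * t2 = Fstar c x y r2 t2 \<Longrightarrow>
      rho x r2 t2 * r1 = rho x r1 t1 * r2 \<and> rho x r2 t2 * t1 = rho x r1 t1 * t2"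
proof -
  define A where "A = x\<^sup>2 + 2*c"
  define m1 where "m1 = rho x r1 t1"
  define m2 where "m2 = rho x r2 t2"
  define R1 where "R1 = rad c x r1 t1"
  define R2 where "R2 = rad c x r2 t2"
  define S where "S = r1 * r2 + t1 * t2 / x\<^sup>2"
  have A: "A > 0" unfolding A_def using c by (simp add: add_nonneg_pos)
  have A16: "16 * x < A\<^sup>2" unfolding A_def by (rule energy_bound[OF c])
  have m: "m1 > 0" "m2 > 0" unfolding m1_def m2_def using x p1 p2 by (simp_all add: rho_pos)
  have sq: "m1\<^sup>2 = r1\<^sup>2 + t1\<^sup>2 / x\<^sup>2" "m2\<^sup>2 = r2\<^sup>2 + t2\<^sup>2 / x\<^sup>2"
    by (simp_all add: m1_def m2_def rho_square)
  have R: "R1 > 0" "R2 > 0"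
    unfolding R1_def R2_def rad_def using radicand_pos[OF c x p1] radicand_pos[OF c x p2] by simp_all
  have lhs: "Fstar_r c x r1 t1 * r2 + Fstar_t c x r1 t1 * t2
      = (A * S / m1 + (A\<^sup>2 * S - 8 * (t1 * S / m1 + m1 * t2)) / R1) / 4"
    unfolding Fstar_r_def Fstar_t_def A_def[symmetric] m1_def[symmetric] R1_def[symmetric] S_def
    using m R x by (simp add: field_simps power2_eq_square)
  have 1: "(r1 / m1)\<^sup>2 + (t1 / (x * m1))\<^sup>2 = 1"
  proof -
    have "(r1 / m1)\<^sup>2 + (t1 / (x * m1))\<^sup>2 = (r1\<^sup>2 + t1\<^sup>2 / x\<^sup>2) / m1\<^sup>2"
      using m x by (simp add: field_simps)
    then show ?thesis using m by (simp flip: sq)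
  qed
  have 2: "(r2 / m2)\<^sup>2 + (t2 / (x * m2))\<^sup>2 = 1"
  proof -
    have "(r2 / m2)\<^sup>2 + (t2 / (x * m2))\<^sup>2 = (r2\<^sup>2 + t2\<^sup>2 / x\<^sup>2) / m2\<^sup>2"
      using m x by (simp add: field_simps)
    then show ?thesis using m by (simp flip: sq)
  qed
  have C: "r1 / m1 * (r2 / m2) + t1 / (x * m1) * (t2 / (x * m2)) = S / (m1 * m2)"
    unfolding S_def using m x by (simp add: field_simps power2_eq_square)
  \<comment> \<open>With this \<open>e\<close>, \<open>R\<close> equals
    \<open>A * sqrt (\<rho>^2 - e * \<rho> * t / x)\<close>, and \<open>energy_bound\<close> gives
    \<open>e \<le> 1\<close>. The inequality for unit vectors is then scaled by
    \<open>A^2 * m1 * m2\<close>.\<close>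
  define e where "e = 16 * x / A\<^sup>2"
  have e: "0 \<le> e" "e \<le> 1" unfolding e_def using A16 A x by simp_all
  have "S / (m1 * m2) - e * (t1 / (x * m1) * (S / (m1 * m2)) + t2 / (x * m2)) / 2
      \<le> sqrt ((1 - e * (t1 / (x * m1))) * (1 - e * (t2 / (x * m2))))"
    using unit_vectors_convexity[OF 1 2 e] unfolding C .
  then have "A\<^sup>2 * m1 * m2 * (S / (m1 * m2) - e * (t1 / (x * m1) * (S / (m1 * m2)) + t2 / (x * m2)) / 2)
      \<le> A\<^sup>2 * m1 * m2 * sqrt ((1 - e * (t1 / (x * m1))) * (1 - e * (t2 / (x * m2))))"
    using m A by (intro mult_left_mono) auto
  moreover have "A\<^sup>2 * m1 * m2 * (S / (m1 * m2) - e * (t1 / (x * m1) * (S / (m1 * m2)) + t2 / (x * m2)) / 2)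
      = A\<^sup>2 * S - 8 * (t1 * S / m1 + m1 * t2)"
    unfolding e_def using m x A by (simp add: field_simps)
  moreover have "A\<^sup>2 * m1 * m2 * sqrt ((1 - e * (t1 / (x * m1))) * (1 - e * (t2 / (x * m2)))) = R1 * R2"
  proof -
    have "R1 = A * m1 * sqrt (1 - e * (t1 / (x * m1)))" (is "_ = ?r")
    proof -
      have "?r = sqrt ((A * m1)\<^sup>2 * (1 - e * (t1 / (x * m1))))" using A m by (simp add: real_sqrt_mult)
      also have "(A * m1)\<^sup>2 * (1 - e * (t1 / (x * m1))) = (A * m1)\<^sup>2 - 16 * t1 * m1"
        unfolding e_def using A m x by (simp add: field_simps power2_eq_square)
      finally show ?thesis unfolding R1_def rad_def A_def m1_def by simp
    qed
    moreover have "R2 = A * m2 * sqrt (1 - e * (t2 / (x * m2)))" (is "_ = ?r")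
    proof -
      have "?r = sqrt ((A * m2)\<^sup>2 * (1 - e * (t2 / (x * m2))))" using A m by (simp add: real_sqrt_mult)
      also have "(A * m2)\<^sup>2 * (1 - e * (t2 / (x * m2))) = (A * m2)\<^sup>2 - 16 * t2 * m2"
        unfolding e_def using A m x by (simp add: field_simps power2_eq_square)
      finally show ?thesis unfolding R2_def rad_def A_def m2_def by simp
    qed
    ultimately show ?thesis by (simp add: real_sqrt_mult power2_eq_square)
  qed
  ultimately have "A\<^sup>2 * S - 8 * (t1 * S / m1 + m1 * t2) \<le> R1 * R2" by (simp only:)
  then have rad_le: "(A\<^sup>2 * S - 8 * (t1 * S / m1 + m1 * t2)) / R1 \<le> R2"
    using R by (simp only: pos_divide_le_eq mult.commute)
  \<comment> \<open>The defect in Cauchy-Schwarz written as a sum of squares, which yields both the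
    inequality and its equality case.\<close>
  have lag: "(m2 * r1 - m1 * r2)\<^sup>2 + ((m2 * t1 - m1 * t2) / x)\<^sup>2 = 2 * m1 * m2 * (m1 * m2 - S)"
  proof -
    have "(m2 * r1 - m1 * r2)\<^sup>2 + ((m2 * t1 - m1 * t2) / x)\<^sup>2
        = m2\<^sup>2 * (r1\<^sup>2 + t1\<^sup>2 / x\<^sup>2) + m1\<^sup>2 * (r2\<^sup>2 + t2\<^sup>2 / x\<^sup>2) - 2 * m1 * m2 * S"
      unfolding S_def using x by (simp add: field_simps power2_eq_square)
    then show ?thesis unfolding sq[symmetric] by (simp add: power2_eq_square algebra_simps)
  qed
  then have "0 \<le> 2 * m1 * m2 * (m1 * m2 - S)" by (metis add_nonneg_nonneg zero_le_power2)
  then have S: "S \<le> m1 * m2" using m by (smt (verit) mult_pos_neg mult_pos_pos)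
  then have "A * S / m1 \<le> A * m2" using A m by (simp add: field_simps)
  moreover have F2: "Fstar c x y r2 t2 = (A * m2 + R2) / 4"
    unfolding Fstar_eq[OF c] A_def m2_def R2_def ..
  ultimately show "Fstar_r c x r1 t1 * r2 + Fstar_t c x r1 t1 * t2 \<le> Fstar c x y r2 t2"
    using rad_le unfolding lhs by simp
  show "rho x r2 t2 * r1 = rho x r1 t1 * r2 \<and> rho x r2 t2 * t1 = rho x r1 t1 * t2"
    if eq: "Fstar_r c x r1 t1 * r2 + Fstar_t c x r1 t1 * t2 = Fstar c x y r2 t2"
  proof -
    \<comment> \<open>If two sums agree and one pair of summands is ordered, the other pair is
      ordered the opposite way; this reverses the Cauchy-Schwarz estimate.\<close>
    have *: "(a + b) / 4 = (d + e) / 4 \<Longrightarrow> b \<le> e \<Longrightarrow> d \<le> a" for a b d e :: real by simp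
    have "A * m2 \<le> A * S / m1" by (rule *[OF eq[unfolded lhs F2] rad_le])
    then have "m1 * m2 \<le> S" using A m by (simp add: field_simps)
    with S have "S = m1 * m2" by simp
    with lag have "(m2 * r1 - m1 * r2)\<^sup>2 + ((m2 * t1 - m1 * t2) / x)\<^sup>2 = 0" by simp
    then show ?thesis using x by (simp add: sum_power2_eq_zero_iff flip: m1_def m2_def)
  qed
qed

text \<open>Euler's identity for a 1-homogeneous function: the numerators regroup into
  \<open>\<rho>^2\<close> and the radicand \<open>R^2\<close>.\<close>

lemma Fstar_euler:
  assumes c: "c > 3/2" and x: "x > 0" and p: "(r, t) \<noteq> (0, 0)"
  shows "Fstar_r c x r t * r + Fstar_t c x r t * t = Fstar c x y r t"
proof -
  define A where "A = x\<^sup>2 + 2*c"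
  define m where "m = rho x r t"
  define R where "R = rad c x r t"
  have m: "m > 0" unfolding m_def using x p by (simp add: rho_pos)
  have R: "R > 0" unfolding R_def rad_def using radicand_pos[OF c x p] by simp
  have sq: "r\<^sup>2 + t\<^sup>2 / x\<^sup>2 = m\<^sup>2" by (simp add: m_def rho_square)
  have R2: "R\<^sup>2 = (A * m)\<^sup>2 - 16 * t * m"
    unfolding R_def rad_def A_def m_def using radicand_pos[OF c x p] by simp
  have "Fstar_r c x r t * r + Fstar_t c x r t * t = (A * (r\<^sup>2 + t\<^sup>2 / x\<^sup>2) / m
      + (A\<^sup>2 * (r\<^sup>2 + t\<^sup>2 / x\<^sup>2) - 8 * t * (r\<^sup>2 + t\<^sup>2 / x\<^sup>2) / m - 8 * m * t) / R) / 4"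
    unfolding Fstar_r_def Fstar_t_def A_def[symmetric] m_def[symmetric] R_def[symmetric]
    using m R x by (simp add: field_simps power2_eq_square)
  also have "\<dots> = (A * m + R\<^sup>2 / R) / 4"
    unfolding sq R2 using m by (simp add: power2_eq_square algebra_simps)
  also have "\<dots> = Fstar c x y r t"
    unfolding Fstar_eq[OF c] A_def m_def R_def using R by (simp add: power2_eq_square)
  finally show ?thesis .
qed

text \<open>Pairing the common image with either covector and applying Euler and the support
  inequality gives \<open>F1^2 \<le> F2 * F1\<close> and \<open>F2^2 \<le> F1 * F2\<close>, so
  \<open>F1 = F2\<close>. The support inequality is then an equality, so the covectors are parallel,
  and equal values of \<open>Fstar\<close> make them coincide.\<close>

lemma Legendre_map_inj:
  assumes c: "c > 3/2" and x: "x > 0" and p1: "(r1, t1) \<noteq> (0, 0)" and p2: "(r2, t2) \<noteq> (0, 0)"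
    and er: "Fstar c x y r1 t1 * Fstar_r c x r1 t1 = Fstar c x y r2 t2 * Fstar_r c x r2 t2"
    and et: "Fstar c x y r1 t1 * Fstar_t c x r1 t1 = Fstar c x y r2 t2 * Fstar_t c x r2 t2"
  shows "r1 = r2 \<and> t1 = t2"
proof -
  define F1 where "F1 = Fstar c x y r1 t1"
  define F2 where "F2 = Fstar c x y r2 t2"
  have F: "F1 > 0" "F2 > 0" unfolding F1_def F2_def using Fstar_pos c x p1 p2 by blast+
  have e1: "Fstar_r c x r1 t1 * r1 + Fstar_t c x r1 t1 * t1 = F1"
    and e2: "Fstar_r c x r2 t2 * r2 + Fstar_t c x r2 t2 * t2 = F2"
    unfolding F1_def F2_def using Fstar_euler c x p1 p2 by blast+
  have i1: "Fstar_r c x r1 t1 * r2 + Fstar_t c x r1 t1 * t2 \<le> F2"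
    and i2: "Fstar_r c x r2 t2 * r1 + Fstar_t c x r2 t2 * t1 \<le> F1"
    unfolding F1_def F2_def using Fstar_gradient_ineq(1) c x p1 p2 by blast+
  have s1: "F1 * F1 = F2 * (Fstar_r c x r2 t2 * r1 + Fstar_t c x r2 t2 * t1)"
    using e1 er et unfolding F1_def[symmetric] F2_def[symmetric] by (metis (no_types, lifting) distrib_left mult.assoc)
  have s2: "F2 * F2 = F1 * (Fstar_r c x r1 t1 * r2 + Fstar_t c x r1 t1 * t2)"
    using e2 er et unfolding F1_def[symmetric] F2_def[symmetric] by (metis (no_types, lifting) distrib_left mult.assoc)
  have "F1 * F1 \<le> F2 * F1" "F2 * F2 \<le> F1 * F2"
    using s1 s2 i1 i2 F by simp_all
  then have eq: "F1 = F2" using F by simp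
  then have g: "Fstar_r c x r1 t1 * r2 + Fstar_t c x r1 t1 * t2 = F2" using s2 F by simp
  then have par: "rho x r2 t2 * r1 = rho x r1 t1 * r2" "rho x r2 t2 * t1 = rho x r1 t1 * t2"
    using Fstar_gradient_ineq(2)[OF c x p1 p2, of y] unfolding F2_def by blast+
  have m: "rho x r1 t1 > 0" "rho x r2 t2 > 0" using x p1 p2 by (simp_all add: rho_pos)
  have "rho x r2 t2 * F1 = Fstar_r c x r1 t1 * (rho x r2 t2 * r1) + Fstar_t c x r1 t1 * (rho x r2 t2 * t1)"
    using e1 by (simp add: algebra_simps flip: e1)
  also have "\<dots> = rho x r1 t1 * F2" unfolding par using g by (simp add: algebra_simps flip: g)
  finally have "rho x r2 t2 = rho x r1 t1" using eq F by simp
  then show ?thesis using par m by (metis less_irrefl mult_cancel_left)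
qed

text \<open>The description in \<open>Lleg\<close> ranges over all covectors, including zero, where
  the gradient formulas do not apply. This value excludes the zero covector as a preimage of a
  vector with \<open>v > 0\<close>.\<close>

lemma Lstar_D4_zero:
  assumes c: "c > 3/2" and x: "x > 0"
  shows "D4 (Lstar c) x y 0 0 = 0"
proof -
  define A where "A = x\<^sup>2 + 2*c"
  \<comment> \<open>By 2-homogeneity, \<open>Lstar\<close> on the axis \<open>r = 0\<close> is
    \<open>t^2\<close> times a constant for each sign of \<open>t\<close>; \<open>k\<close> supplies
    it as a function of \<open>sgn t\<close>. The value \<open>k 0\<close> only ever meets the
    factor zero.\<close>
  define k where "k = (\<lambda>s::real. (A / x + sqrt ((A / x)\<^sup>2 - 16 * s / x))\<^sup>2 / 32)"
  have L: "Lstar c x y 0 t = t\<^sup>2 * k (sgn t)" for t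
  proof -
    have rho: "rho x 0 t = \<bar>t\<bar> / x" using x by (simp add: rho_def real_sqrt_divide)
    have "rad c x 0 t = sqrt (t\<^sup>2 * ((A / x)\<^sup>2 - 16 * sgn t / x))"
      unfolding rad_def rho A_def[symmetric] using x
      by (intro arg_cong[where f = sqrt]) (cases t "0::real" rule: linorder_cases; simp add: field_simps power2_eq_square)
    also have "\<dots> = \<bar>t\<bar> * sqrt ((A / x)\<^sup>2 - 16 * sgn t / x)" by (simp add: real_sqrt_mult)
    finally have "Fstar c x y 0 t = \<bar>t\<bar> * (A / x + sqrt ((A / x)\<^sup>2 - 16 * sgn t / x)) / 4"
      unfolding Fstar_eq[OF c] A_def[symmetric] rho by (simp add: algebra_simps)
    then show ?thesis unfolding Lstar_def k_def by (simp only: power_mult_distrib power_divide power2_abs) simp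
  qed
  have kb: "\<bar>k (sgn t)\<bar> \<le> \<bar>k 1\<bar> + \<bar>k 0\<bar> + \<bar>k (-1)\<bar>" for t by (simp add: sgn_if)
  have "((\<lambda>t. t * k (sgn t)) \<longlongrightarrow> 0) (at 0)"
  proof (rule Lim_null_comparison)
    show "\<forall>\<^sub>F t in at 0. norm (t * k (sgn t)) \<le> \<bar>t\<bar> * (\<bar>k 1\<bar> + \<bar>k 0\<bar> + \<bar>k (-1)\<bar>)"
      using kb by (intro always_eventually) (simp add: abs_mult mult_left_mono)
    show "((\<lambda>t. \<bar>t\<bar> * (\<bar>k 1\<bar> + \<bar>k 0\<bar> + \<bar>k (-1)\<bar>)) \<longlongrightarrow> 0) (at 0)"
      by (intro tendsto_mult_left_zero tendsto_rabs_zero tendsto_ident_at)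
  qed
  moreover have "(\<lambda>h. (Lstar c x y 0 (0 + h) - Lstar c x y 0 0) / h) = (\<lambda>t. t * k (sgn t))"
    unfolding L by (auto simp: power2_eq_square)
  ultimately have "((\<lambda>s. Lstar c x y 0 s) has_real_derivative 0) (at 0)"
    unfolding DERIV_def by simp
  then show ?thesis unfolding D4_def by (rule DERIV_imp_deriv)
qed

section \<open>Implicit functions of two real variables\<close>

lemma has_derivative_along_curve:
  fixes f :: "real \<Rightarrow> real \<Rightarrow> real"
  assumes "((\<lambda>p. f (fst p) (snd p)) has_derivative (\<lambda>h. a * fst h + b * snd h)) (at (g s, k s))"
    and "(g has_real_derivative g') (at s)" "(k has_real_derivative k') (at s)"
  shows "((\<lambda>s. f (g s) (k s)) has_real_derivative a * g' + b * k') (at s)"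
proof -
  have "((\<lambda>s. (g s, k s)) has_derivative (\<lambda>h. (h * g', h * k'))) (at s)"
    using assms(2,3) by (auto intro!: derivative_eq_intros simp: has_field_derivative_def mult_commute_abs)
  from has_derivative_compose[OF this assms(1)]
  have "((\<lambda>s. f (g s) (k s)) has_derivative (\<lambda>h. a * (h * g') + b * (h * k'))) (at s)" by simp
  moreover have "(\<lambda>h. a * (h * g') + b * (h * k')) = (*) (a * g' + b * k')"
    by (auto simp: algebra_simps)
  ultimately show ?thesis by (simp add: has_field_derivative_def)
qed

text \<open>\<open>W\<close> is the second component of the inverse of
  \<open>(x, w) \<mapsto> (x, y x w)\<close>. Monotonicity in \<open>w\<close> gives injectivity,
  invariance of domain an open image, and the inverse function theorem the derivative.\<close>

lemma implicit_function_of_partial_pos: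
  fixes y yx yw :: "real \<Rightarrow> real \<Rightarrow> real"
  assumes S: "open S" "(x0, w0) \<in> S"
    and der: "\<And>x w. (x, w) \<in> S \<Longrightarrow>
      ((\<lambda>p. y (fst p) (snd p)) has_derivative (\<lambda>h. yx x w * fst h + yw x w * snd h)) (at (x, w))"
    and pos: "\<And>x w. (x, w) \<in> S \<Longrightarrow> yw x w > 0"
  obtains U W where "open U" "(x0, y x0 w0) \<in> U" "W x0 (y x0 w0) = w0"
    and "\<And>x n. (x, n) \<in> U \<Longrightarrow> (x, W x n) \<in> S \<and> y x (W x n) = n"
    and "\<And>x n. (x, n) \<in> U \<Longrightarrow> ((\<lambda>p. W (fst p) (snd p)) has_derivative
      (\<lambda>h. - yx x (W x n) / yw x (W x n) * fst h + 1 / yw x (W x n) * snd h)) (at (x, n))"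
proof -
  obtain I J where IJ: "open I" "open J" "x0 \<in> I" "w0 \<in> J" "I \<times> J \<subseteq> S"
    using open_prod_elim[OF S] by (metis mem_Sigma_iff)
  obtain e where e: "e > 0" "ball w0 e \<subseteq> J" using IJ open_contains_ball by blast
  \<comment> \<open>A product with an interval as second factor: the segment between two points over
    the same \<open>x\<close> stays inside, which the monotonicity argument requires.\<close>
  define S' where "S' = I \<times> ball w0 e"
  have S': "open S'" "S' \<subseteq> S" "(x0, w0) \<in> S'"
    unfolding S'_def using IJ e by (auto intro: open_Times)
  define f where "f = (\<lambda>p. (fst p, y (fst p) (snd p)))"
  have less: "y x w1 < y x w2" if "(x, w1) \<in> S'" "(x, w2) \<in> S'" "w1 < w2" for x w1 w2
  proof (rule DERIV_pos_imp_increasing[OF that(3)])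
    fix w assume w: "w1 \<le> w" "w \<le> w2"
    have "(x, w) \<in> S'" using that w unfolding S'_def by (auto simp: dist_real_def)
    then have "(x, w) \<in> S" using S' by blast
    from has_derivative_along_curve[where g = "\<lambda>_. x" and k = "\<lambda>w. w", OF der[OF this], of 0 1] pos[OF this]
    show "\<exists>d. ((\<lambda>w. y x w) has_real_derivative d) (at w) \<and> 0 < d" by auto
  qed
  have inj: "inj_on f S'"
  proof (rule inj_onI)
    fix p q assume pq: "p \<in> S'" "q \<in> S'" "f p = f q"
    then have "fst p = fst q" "y (fst p) (snd p) = y (fst p) (snd q)" by (auto simp: f_def)
    moreover have "\<not> snd p < snd q" "\<not> snd q < snd p"
      using less[of "fst p" "snd p" "snd q"] less[of "fst p" "snd q" "snd p"] pq(1,2) calculation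
      by (auto; metis prod.collapse less_irrefl)+
    ultimately show "p = q" by (simp add: prod_eq_iff)
  qed
  have derf: "(f has_derivative (\<lambda>h. (fst h, yx x w * fst h + yw x w * snd h))) (at (x, w))"
    if "(x, w) \<in> S'" for x w
    unfolding f_def using der[of x w] that S'(2) by (auto intro!: derivative_eq_intros)
  have cont: "continuous_on S' f"
    using derf S'(1) by (auto simp: continuous_on_eq_continuous_at intro: has_derivative_continuous)
  define g where "g = inv_into S' f"
  define W where "W = (\<lambda>x n. snd (g (x, n)))"
  have gf: "g (f p) = p" if "p \<in> S'" for p unfolding g_def using inj that by (rule inv_into_f_f)
  have g: "g (x, n) = (x, W x n)" "(x, W x n) \<in> S'" "y x (W x n) = n" if "(x, n) \<in> f ` S'" for x n
  proof -
    from that obtain p where p: "p \<in> S'" "(x, n) = f p" by auto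
    then have gp: "g (x, n) = p" using gf by simp
    show "g (x, n) = (x, W x n)" "(x, W x n) \<in> S'" "y x (W x n) = n"
      using p gp unfolding W_def f_def by (auto simp: prod_eq_iff)
  qed
  show ?thesis
  proof (rule that[of "f ` S'" W])
    show "open (f ` S')" using cont S'(1) inj by (rule invariance_of_domain)
    show "(x0, y x0 w0) \<in> f ` S'" using S'(3) by (force simp: f_def)
    show "W x0 (y x0 w0) = w0" using gf[OF S'(3)] by (simp add: W_def f_def)
    show "(x, W x n) \<in> S \<and> y x (W x n) = n" if "(x, n) \<in> f ` S'" for x n
      using g[OF that] S'(2) by auto
    show "((\<lambda>p. W (fst p) (snd p)) has_derivative
      (\<lambda>h. - yx x (W x n) / yw x (W x n) * fst h + 1 / yw x (W x n) * snd h)) (at (x, n))"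
      if "(x, n) \<in> f ` S'" for x n
    proof -
      define w where "w = W x n"
      have w: "(x, w) \<in> S'" "f (x, w) = (x, n)" using g[OF that] by (auto simp: w_def f_def)
      have yw: "yw x w > 0" using pos w S'(2) by blast
      have "(g has_derivative (\<lambda>h. (fst h, - yx x w / yw x w * fst h + 1 / yw x w * snd h))) (at (f (x, w)))"
        by (rule has_derivative_inverse_strong[OF S'(1) w(1) cont gf derf[OF w(1)]])
          (use yw in \<open>auto simp: fun_eq_iff field_simps\<close>)
      then have "((\<lambda>p. snd (g p)) has_derivative (\<lambda>h. - yx x w / yw x w * fst h + 1 / yw x w * snd h)) (at (x, n))"
        unfolding w(2) by (auto dest: has_derivative_snd)
      then show ?thesis unfolding w_def W_def by simp
    qed
  qed
qed

section \<open>Rational parametrisation of the Legendre map\<close>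

text \<open>
  The parameter is \<open>w = A Fstar / t\<close>, always \<open>> 4\<close> when \<open>t > 0\<close>, and \<open>A\<^sup>2 \<rho> / t = xi w\<close>. In these terms
  \<open>u = r Qf\<close>, \<open>v = t Vf\<close>, \<open>r\<^sup>2 / t\<^sup>2 = Bf\<close> and \<open>u\<^sup>2 / v\<^sup>2 = Yf\<close>. The suffixes \<open>x\<close> and \<open>w\<close> mark partial
  derivatives with the other one of \<open>x\<close>, \<open>w\<close> held fixed. Values \<open>Bf < 0\<close> correspond to no covector,
  but they make \<open>u = 0\<close> an interior point of the parametrisation.
\<close>

definition ka :: "real \<Rightarrow> real" where "ka w = (w - 2)^3 / (4 * w\<^sup>2 * (w - 4))"
definition ka' :: "real \<Rightarrow> real" where "ka' w = (w - 2)\<^sup>2 * (w - 8) / (2 * w^3 * (w - 4)\<^sup>2)"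
definition jj :: "real \<Rightarrow> real" where "jj w = 2 * w\<^sup>2 / (w - 4)"
definition jj' :: "real \<Rightarrow> real" where "jj' w = 2 * w * (w - 8) / (w - 4)\<^sup>2"
text \<open>With \<open>z = A^2 \<rho> / t\<close>, the definition of \<open>w\<close> reads
  \<open>4 w = z + sqrt (z^2 - 16 z)\<close>; squaring makes the equation linear in
  \<open>z\<close>, with this solution.\<close>

definition xi :: "real \<Rightarrow> real" where "xi w = 2 * w\<^sup>2 / (w - 2)"
definition xi' :: "real \<Rightarrow> real" where "xi' w = 2 * w * (w - 4) / (w - 2)\<^sup>2"

lemma ka_deriv: "w > 4 \<Longrightarrow> (ka has_real_derivative ka' w) (at w)"
proof -
  assume w: "w > 4"
  have "((\<lambda>w. (w - 2)^3 / (4 * w\<^sup>2 * (w - 4))) has_real_derivative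
     (3 * (w - 2)\<^sup>2 * (4 * w\<^sup>2 * (w - 4)) - (w - 2)^3 * (4 * (2 * w) * (w - 4) + 4 * w\<^sup>2)) / (4 * w\<^sup>2 * (w - 4))\<^sup>2) (at w)"
    using w by (auto intro!: derivative_eq_intros simp: power2_eq_square algebra_simps)
  moreover have "(3 * (w - 2)\<^sup>2 * (4 * w\<^sup>2 * (w - 4)) - (w - 2)^3 * (4 * (2 * w) * (w - 4) + 4 * w\<^sup>2)) / (4 * w\<^sup>2 * (w - 4))\<^sup>2 = ka' w"
  proof -
    have "(3 * (w - 2)\<^sup>2 * (4 * w\<^sup>2 * (w - 4)) - (w - 2)^3 * (4 * (2 * w) * (w - 4) + 4 * w\<^sup>2)) * (2 * w^3 * (w - 4)\<^sup>2)
      = (w - 2)\<^sup>2 * (w - 8) * (4 * w\<^sup>2 * (w - 4))\<^sup>2" by algebra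
    then show ?thesis unfolding ka'_def using w by (simp add: frac_eq_eq)
  qed
  ultimately show ?thesis unfolding ka_def[abs_def] by simp
qed

lemma jj_deriv: "w > 4 \<Longrightarrow> (jj has_real_derivative jj' w) (at w)"
  unfolding jj_def[abs_def] jj'_def
  by (auto intro!: derivative_eq_intros simp: divide_simps power2_eq_square) algebra

lemma xi_deriv: "w > 4 \<Longrightarrow> (xi has_real_derivative xi' w) (at w)"
  unfolding xi_def[abs_def] xi'_def
  by (auto intro!: derivative_eq_intros simp: divide_simps power2_eq_square) algebra

lemma xi_ka: "w > 4 \<Longrightarrow> (xi w)\<^sup>2 * ka w - jj w = w\<^sup>2"
  unfolding xi_def ka_def jj_def by (simp add: divide_simps power_divide) algebra

lemma xi_ka': "w > 4 \<Longrightarrow> (xi w)\<^sup>2 * ka' w = jj' w"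
  unfolding xi_def ka'_def jj'_def by (simp add: divide_simps power_divide) (simp add: power3_eq_cube power4_eq_xxxx)

lemma ka_pos: "w > 4 \<Longrightarrow> ka w > 0" by (simp add: ka_def)
lemma xi_pos: "w > 4 \<Longrightarrow> xi w > 0" by (simp add: xi_def)
lemma xi'_pos: "w > 4 \<Longrightarrow> xi' w > 0" by (simp add: xi'_def)

definition Af :: "real \<Rightarrow> real \<Rightarrow> real" where "Af c x = x\<^sup>2 + 2 * c"
definition Qf where "Qf c x w = (Af c x)\<^sup>2 * ka w"
definition Qx where "Qx c x w = 4 * x * Af c x * ka w"
definition Qw where "Qw c x w = (Af c x)\<^sup>2 * ka' w"
definition Vf where "Vf c x w = Qf c x w / x\<^sup>2 - jj w / (Af c x)\<^sup>2"
definition Vx where "Vx c x w = Qx c x w / x\<^sup>2 - 2 * Qf c x w / x^3 + 4 * x * jj w / (Af c x)^3"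
definition Vw where "Vw c x w = Qw c x w / x\<^sup>2 - jj' w / (Af c x)\<^sup>2"
definition Bf where "Bf c x w = (xi w)\<^sup>2 / (Af c x)^4 - 1 / x\<^sup>2"
definition Bx where "Bx c x w = 2 / x^3 - 8 * x * (xi w)\<^sup>2 / (Af c x)^5"
definition Bw where "Bw c x w = 2 * xi w * xi' w / (Af c x)^4"
definition Yf where "Yf c x w = Bf c x w * (Qf c x w)\<^sup>2 / (Vf c x w)\<^sup>2"
text \<open>The factor of \<open>Yw\<close> that decides its sign where \<open>Qf\<close> and
  \<open>Vf\<close> are positive. It is also the denominator of the Hessian determinant
  \<open>Bw / Tf\<close> of the Lagrangian.\<close>

definition Tf where "Tf c x w = Bw c x w * Qf c x w * Vf c x w - 2 * (w / Af c x)\<^sup>2 * Vw c x w"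
definition Yx where "Yx c x w = (Qf c x w / Vf c x w)\<^sup>2 *
   (Bx c x w + 2 * Bf c x w * Qx c x w / Qf c x w - 2 * Bf c x w * Vx c x w / Vf c x w)"
definition Yw where "Yw c x w = Qf c x w * Tf c x w / (Vf c x w)^3"

lemma Af_pos: "c > 3/2 \<Longrightarrow> Af c x > 0"
  by (simp add: Af_def add_nonneg_pos)

lemma Qf_pos: "c > 3/2 \<Longrightarrow> w > 4 \<Longrightarrow> Qf c x w > 0"
  using Af_pos[of c x] ka_pos[of w] by (simp add: Qf_def)

lemma Bw_pos: "c > 3/2 \<Longrightarrow> w > 4 \<Longrightarrow> Bw c x w > 0"
  using Af_pos[of c x] xi_pos[of w] xi'_pos[of w] by (simp add: Bw_def)

text \<open>Euler's relation \<open>r u + t v = Fstar^2\<close> divided by \<open>t^2\<close>, since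
  \<open>u = r Qf\<close>, \<open>v = t Vf\<close> and \<open>Fstar = t w / A\<close>.\<close>

lemma V_plus_BQ:
  assumes "c > 3/2" "x > 0" "w > 4"
  shows "Vf c x w + Bf c x w * Qf c x w = (w / Af c x)\<^sup>2"
proof -
  have A: "Af c x > 0" using assms by (simp add: Af_pos)
  have "Vf c x w + Bf c x w * Qf c x w = ((xi w)\<^sup>2 * ka w - jj w) / (Af c x)\<^sup>2"
    unfolding Vf_def Bf_def Qf_def using A assms by (simp add: field_simps)
  then show ?thesis using assms by (simp add: xi_ka power_divide)
qed

text \<open>The envelope condition of the Legendre transform: it makes
  \<open>u^2 / Qf + v^2 / Vf\<close> stationary in \<open>w\<close> at fixed \<open>x\<close>,
  \<open>u\<close>, \<open>v\<close>.\<close>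

lemma Vw_eq:
  assumes "c > 3/2" "x > 0" "w > 4"
  shows "Vw c x w = - Bf c x w * Qw c x w"
proof -
  have A: "Af c x > 0" using assms by (simp add: Af_pos)
  have "Vw c x w + Bf c x w * Qw c x w = ((xi w)\<^sup>2 * ka' w - jj' w) / (Af c x)\<^sup>2"
    unfolding Vw_def Bf_def Qw_def using A assms by (simp add: field_simps)
  then show ?thesis using assms by (simp add: xi_ka')
qed

text \<open>The \<open>x\<close>-derivative of \<open>V_plus_BQ\<close> at fixed \<open>w\<close>;
  the right side is that of \<open>(w / A)^2\<close>.\<close>

lemma Vx_plus:
  assumes "c > 3/2" "x > 0" "w > 4"
  shows "Vx c x w + Bx c x w * Qf c x w + Bf c x w * Qx c x w = - 4 * x * w\<^sup>2 / (Af c x)^3"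
proof -
  have A: "Af c x > 0" using assms by (simp add: Af_pos)
  have "Vx c x w + Bx c x w * Qf c x w + Bf c x w * Qx c x w
      = - 4 * x * ((xi w)\<^sup>2 * ka w - jj w) / (Af c x)^3"
    unfolding Vx_def Bx_def Bf_def Qf_def Qx_def using A assms
    by (simp add: field_simps) (simp add: power2_eq_square power3_eq_cube power4_eq_xxxx algebra_simps numeral_eq_Suc)
  then show ?thesis using assms by (simp add: xi_ka)
qed

lemma Af_has_derivative:
  "((\<lambda>p. Af c (fst p)) has_derivative (\<lambda>h. 2 * x * fst h)) (at (x, w))"
  unfolding Af_def by (auto intro!: derivative_eq_intros)

lemma has_derivative_snd_compose:
  assumes "(f has_real_derivative f') (at w)"
  shows "((\<lambda>p. f (snd p)) has_derivative (\<lambda>h. f' * snd h)) (at (x, w))"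
proof -
  have "((\<lambda>p. snd p) has_derivative (\<lambda>h. snd h)) (at (x, w))" by (auto intro!: derivative_eq_intros)
  from DERIV_compose_FDERIV[OF _ this] assms show ?thesis by (simp add: mult.commute)
qed

lemma Qf_has_derivative:
  assumes "w > 4"
  shows "((\<lambda>p. Qf c (fst p) (snd p)) has_derivative (\<lambda>h. Qx c x w * fst h + Qw c x w * snd h)) (at (x, w))"
  unfolding Qf_def Qx_def Qw_def
  by (rule derivative_eq_intros Af_has_derivative has_derivative_snd_compose[OF ka_deriv[OF assms]] refl)+
    (simp add: fun_eq_iff algebra_simps power2_eq_square)

lemma Vf_has_derivative:
  assumes "c > 3/2" "x > 0" "w > 4"
  shows "((\<lambda>p. Vf c (fst p) (snd p)) has_derivative (\<lambda>h. Vx c x w * fst h + Vw c x w * snd h)) (at (x, w))"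
  unfolding Vf_def using Af_pos[OF assms(1), of x] assms(2)
  by - ((rule derivative_eq_intros Qf_has_derivative[OF assms(3)] Af_has_derivative
      has_derivative_snd_compose[OF jj_deriv[OF assms(3)]] refl | simp)+,
      simp add: fun_eq_iff Vx_def Vw_def field_simps power2_eq_square power3_eq_cube)

lemma Bf_has_derivative:
  assumes "c > 3/2" "x > 0" "w > 4"
  shows "((\<lambda>p. Bf c (fst p) (snd p)) has_derivative (\<lambda>h. Bx c x w * fst h + Bw c x w * snd h)) (at (x, w))"
  unfolding Bf_def using Af_pos[OF assms(1), of x] assms(2)
  by - ((rule derivative_eq_intros Af_has_derivative has_derivative_snd_compose[OF xi_deriv[OF assms(3)]] refl | simp)+,
      simp add: fun_eq_iff Bx_def Bw_def field_simps numeral_eq_Suc)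

text \<open>\<open>V_plus_BQ\<close> and \<open>Vw_eq\<close> condense the quotient rule into the
  product that defines \<open>Yw\<close>, from which its sign can be read off.\<close>

lemma Yw_eq:
  assumes "c > 3/2" "x > 0" "w > 4" and V: "Vf c x w > 0"
  shows "Yw c x w = (Qf c x w / Vf c x w)\<^sup>2 *
   (Bw c x w + 2 * Bf c x w * Qw c x w / Qf c x w - 2 * Bf c x w * Vw c x w / Vf c x w)"
proof -
  have Q: "Qf c x w > 0" using assms by (simp add: Qf_pos)
  show ?thesis
    unfolding Yw_def Tf_def V_plus_BQ[OF assms(1-3), symmetric] Vw_eq[OF assms(1-3)]
    using Q V by (simp add: field_simps power2_eq_square power3_eq_cube)
qed

lemma Yf_has_derivative:
  assumes "c > 3/2" "x > 0" "w > 4" and V: "Vf c x w > 0"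
  shows "((\<lambda>p. Yf c (fst p) (snd p)) has_derivative (\<lambda>h. Yx c x w * fst h + Yw c x w * snd h)) (at (x, w))"
proof -
  have Q: "Qf c x w > 0" using assms by (simp add: Qf_pos)
  show ?thesis
    unfolding Yf_def Yw_eq[OF assms] Yx_def using V Q
    by - ((rule derivative_eq_intros Qf_has_derivative[OF assms(3)] Vf_has_derivative[OF assms(1-3)]
      Bf_has_derivative[OF assms(1-3)] refl | simp)+,
      simp add: fun_eq_iff field_simps power2_eq_square)
qed

section \<open>The Lagrangian on the dual chart\<close>

text \<open>The local solution \<open>w = W x n\<close> of \<open>Yf c x w = n\<close>, to be used
  at \<open>n = u^2 / v^2\<close>. Since \<open>U\<close> is open, a point with \<open>n = 0\<close>
  in it has neighbours with \<open>n < 0\<close>.\<close>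

locale dual_chart =
  fixes c :: real and U :: "(real \<times> real) set" and W :: "real \<Rightarrow> real \<Rightarrow> real"
  assumes c: "c > 3/2" and U: "open U"
    and chart: "\<And>x n. (x, n) \<in> U \<Longrightarrow>
      x > 0 \<and> W x n > 4 \<and> Vf c x (W x n) > 0 \<and> Tf c x (W x n) > 0 \<and> Yf c x (W x n) = n"
    and W_has_derivative: "\<And>x n. (x, n) \<in> U \<Longrightarrow> ((\<lambda>p. W (fst p) (snd p)) has_derivative
      (\<lambda>h. - Yx c x (W x n) / Yw c x (W x n) * fst h + 1 / Yw c x (W x n) * snd h)) (at (x, n))"
begin

definition chart_dom :: "real \<Rightarrow> real \<Rightarrow> real \<Rightarrow> bool" where
  "chart_dom x u v \<longleftrightarrow> v > 0 \<and> (x, u\<^sup>2 / v\<^sup>2) \<in> U"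

definition ww :: "real \<Rightarrow> real \<Rightarrow> real \<Rightarrow> real" where
  "ww x u v = W x (u\<^sup>2 / v\<^sup>2)"

lemma chart_domD:
  assumes "chart_dom x u v"
  shows "v > 0" "x > 0" "ww x u v > 4" "Vf c x (ww x u v) > 0" "Tf c x (ww x u v) > 0"
    "Qf c x (ww x u v) > 0" "Bw c x (ww x u v) > 0" "Yw c x (ww x u v) > 0" "Af c x > 0"
    "Yf c x (ww x u v) = u\<^sup>2 / v\<^sup>2"
proof -
  show *: "v > 0" "x > 0" "ww x u v > 4" "Vf c x (ww x u v) > 0" "Tf c x (ww x u v) > 0"
      "Yf c x (ww x u v) = u\<^sup>2 / v\<^sup>2"
    using assms chart unfolding chart_dom_def ww_def by blast+
  then show **: "Qf c x (ww x u v) > 0" "Bw c x (ww x u v) > 0" "Af c x > 0"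
    using c by (simp_all add: Qf_pos Bw_pos Af_pos)
  show "Yw c x (ww x u v) > 0" unfolding Yw_def using * ** by simp
qed

lemma u_square: "chart_dom x u v \<Longrightarrow> u\<^sup>2 = v\<^sup>2 * (Bf c x (ww x u v) * (Qf c x (ww x u v))\<^sup>2 / (Vf c x (ww x u v))\<^sup>2)"
  using chart_domD[of x u v] by (simp add: Yf_def field_simps)

lemma eventually_chart_dom:
  assumes "chart_dom x u v"
  shows "eventually (\<lambda>s. chart_dom s u v) (nhds x)" "eventually (\<lambda>s. chart_dom x s v) (nhds u)"
    "eventually (\<lambda>s. chart_dom x u s) (nhds v)"
proof -
  have v: "v > 0" and m: "(x, u\<^sup>2 / v\<^sup>2) \<in> U" using assms by (simp_all add: chart_dom_def)
  have "((\<lambda>s. (s, u\<^sup>2 / v\<^sup>2)) \<longlongrightarrow> (x, u\<^sup>2 / v\<^sup>2)) (nhds x)"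
    by (intro tendsto_intros filterlim_ident)
  from topological_tendstoD[OF this U m] show "eventually (\<lambda>s. chart_dom s u v) (nhds x)"
    using v by (simp add: chart_dom_def)
  have "((\<lambda>s. (x, s\<^sup>2 / v\<^sup>2)) \<longlongrightarrow> (x, u\<^sup>2 / v\<^sup>2)) (nhds u)"
    using v by (intro tendsto_intros filterlim_ident) auto
  from topological_tendstoD[OF this U m] show "eventually (\<lambda>s. chart_dom x s v) (nhds u)"
    using v by (simp add: chart_dom_def)
  have "((\<lambda>s. (x, u\<^sup>2 / s\<^sup>2)) \<longlongrightarrow> (x, u\<^sup>2 / v\<^sup>2)) (nhds v)"
    using v by (intro tendsto_intros filterlim_ident) auto
  from topological_tendstoD[OF this U m] have "eventually (\<lambda>s. (x, u\<^sup>2 / s\<^sup>2) \<in> U) (nhds v)" .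
  moreover have "eventually (\<lambda>s. s > 0) (nhds v)" by (rule order_tendstoD(1)[OF filterlim_ident v])
  ultimately show "eventually (\<lambda>s. chart_dom x u s) (nhds v)"
    by eventually_elim (simp add: chart_dom_def)
qed

text \<open>\<open>deriv\<close> depends only on the germ of a function, so a closed form valid
  throughout the chart may be differentiated in place of the original.\<close>

lemma D1_eqI:
  assumes "\<And>x u v. chart_dom x u v \<Longrightarrow> f x y u v = g x u v" "chart_dom x u v"
    "((\<lambda>s. g s u v) has_real_derivative d) (at x)"
  shows "D1 f x y u v = d"
proof -
  have "deriv (\<lambda>s. f s y u v) x = deriv (\<lambda>s. g s u v) x"
    by (rule deriv_cong_ev[OF eventually_mono[OF eventually_chart_dom(1)[OF assms(2)]] refl]) (rule assms(1))
  then show ?thesis unfolding D1_def using DERIV_imp_deriv[OF assms(3)] by simp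
qed

lemma D3_eqI:
  assumes "\<And>x u v. chart_dom x u v \<Longrightarrow> f x y u v = g x u v" "chart_dom x u v"
    "((\<lambda>s. g x s v) has_real_derivative d) (at u)"
  shows "D3 f x y u v = d"
proof -
  have "deriv (\<lambda>s. f x y s v) u = deriv (\<lambda>s. g x s v) u"
    by (rule deriv_cong_ev[OF eventually_mono[OF eventually_chart_dom(2)[OF assms(2)]] refl]) (rule assms(1))
  then show ?thesis unfolding D3_def using DERIV_imp_deriv[OF assms(3)] by simp
qed

lemma D4_eqI:
  assumes "\<And>x u v. chart_dom x u v \<Longrightarrow> f x y u v = g x u v" "chart_dom x u v"
    "((\<lambda>s. g x u s) has_real_derivative d) (at v)"
  shows "D4 f x y u v = d"
proof -
  have "deriv (\<lambda>s. f x y u s) v = deriv (\<lambda>s. g x u s) v"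
    by (rule deriv_cong_ev[OF eventually_mono[OF eventually_chart_dom(3)[OF assms(2)]] refl]) (rule assms(1))
  then show ?thesis unfolding D4_def using DERIV_imp_deriv[OF assms(3)] by simp
qed

lemma ww_deriv_x:
  assumes "chart_dom x u v"
  shows "((\<lambda>s. ww s u v) has_real_derivative - Yx c x (ww x u v) / Yw c x (ww x u v)) (at x)"
proof -
  have m: "(x, u\<^sup>2 / v\<^sup>2) \<in> U" using assms by (simp add: chart_dom_def)
  from has_derivative_along_curve[where g = "\<lambda>s. s" and k = "\<lambda>s. u\<^sup>2 / v\<^sup>2", OF W_has_derivative[OF m], of 1 0]
  show ?thesis unfolding ww_def by simp
qed

lemma ww_deriv_u:
  assumes "chart_dom x u v"
  shows "((\<lambda>s. ww x s v) has_real_derivative 2 * u / (v\<^sup>2 * Yw c x (ww x u v))) (at u)"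
proof -
  have m: "(x, u\<^sup>2 / v\<^sup>2) \<in> U" using assms by (simp add: chart_dom_def)
  have "((\<lambda>s. s\<^sup>2 / v\<^sup>2) has_real_derivative 2 * u / v\<^sup>2) (at u)"
    using chart_domD[OF assms] by (auto intro!: derivative_eq_intros simp: field_simps numeral_eq_Suc)
  from has_derivative_along_curve[where g = "\<lambda>s. x" and k = "\<lambda>s. s\<^sup>2 / v\<^sup>2", OF W_has_derivative[OF m] _ this, of 0]
  show ?thesis unfolding ww_def by (simp add: mult.commute)
qed

lemma ww_deriv_v:
  assumes "chart_dom x u v"
  shows "((\<lambda>s. ww x u s) has_real_derivative - 2 * u\<^sup>2 / (v^3 * Yw c x (ww x u v))) (at v)"
proof -
  have m: "(x, u\<^sup>2 / v\<^sup>2) \<in> U" using assms by (simp add: chart_dom_def)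
  have "((\<lambda>s. u\<^sup>2 / s\<^sup>2) has_real_derivative - 2 * u\<^sup>2 / v^3) (at v)"
    using chart_domD[OF assms] by (auto intro!: derivative_eq_intros simp: field_simps numeral_eq_Suc)
  from has_derivative_along_curve[where g = "\<lambda>s. x" and k = "\<lambda>s. u\<^sup>2 / s\<^sup>2", OF W_has_derivative[OF m] _ this, of 0]
  show ?thesis unfolding ww_def by (simp add: mult.commute)
qed

lemma chart_deriv:
  assumes "chart_dom x u v"
    and f: "((\<lambda>p. f (fst p) (snd p)) has_derivative (\<lambda>h. a * fst h + b * snd h)) (at (x, ww x u v))"
  shows "((\<lambda>s. f s (ww s u v)) has_real_derivative a + b * (- Yx c x (ww x u v) / Yw c x (ww x u v))) (at x)"
    and "((\<lambda>s. f x (ww x s v)) has_real_derivative b * (2 * u / (v\<^sup>2 * Yw c x (ww x u v)))) (at u)"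
    and "((\<lambda>s. f x (ww x u s)) has_real_derivative b * (- 2 * u\<^sup>2 / (v^3 * Yw c x (ww x u v)))) (at v)"
  using has_derivative_along_curve[where g = "\<lambda>s. s" and k = "\<lambda>s. ww s u v", OF f _ ww_deriv_x[OF assms(1)], of 1]
    has_derivative_along_curve[where g = "\<lambda>s. x" and k = "\<lambda>s. ww x s v", OF f _ ww_deriv_u[OF assms(1)], of 0]
    has_derivative_along_curve[where g = "\<lambda>s. x" and k = "\<lambda>s. ww x u s", OF f _ ww_deriv_v[OF assms(1)], of 0]
  by simp_all


text \<open>By \<open>u_square\<close> the covector \<open>(u / Q, v / V)\<close> satisfies
  \<open>r^2 / t^2 = Bf\<close>, hence \<open>A^2 \<rho> / t = xi w\<close>. Both roots in
  \<open>Fstar\<close> then become rational in \<open>w\<close>, and the gradient can be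
  evaluated.\<close>

lemma Legendre_image:
  assumes d: "chart_dom x u v"
  defines "Q \<equiv> Qf c x (ww x u v)" and "V \<equiv> Vf c x (ww x u v)"
  shows "Fstar c x y (u / Q) (v / V) * Fstar_r c x (u / Q) (v / V) = u"
    and "Fstar c x y (u / Q) (v / V) * Fstar_t c x (u / Q) (v / V) = v"
    and "Lstar c x y (u / Q) (v / V) = (u\<^sup>2 / Q + v\<^sup>2 / V) / 2"
proof -
  define w where "w = ww x u v"
  define A where "A = Af c x"
  define B where "B = Bf c x w"
  define r where "r = u / Q"
  define t where "t = v / V"
  have V: "V > 0" and Q: "Q > 0" and w: "w > 4" and x: "x > 0" and A: "A > 0" and v: "v > 0"
    using chart_domD[OF d] unfolding V_def Q_def w_def A_def by auto
  have t: "t > 0" using V v by (simp add: t_def)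
  have u2: "u\<^sup>2 = v\<^sup>2 * (B * Q\<^sup>2 / V\<^sup>2)" using u_square[OF d] unfolding B_def Q_def V_def w_def .
  have xi: "xi w > 0" using w by (rule xi_pos)
  have "r\<^sup>2 + t\<^sup>2 / x\<^sup>2 = t\<^sup>2 * (B + 1 / x\<^sup>2)"
    unfolding r_def t_def using Q V x by (simp add: power_divide u2 field_simps)
  also have "B + 1 / x\<^sup>2 = (xi w / A\<^sup>2)\<^sup>2" unfolding B_def Bf_def A_def by (simp add: power_divide)
  finally have "r\<^sup>2 + t\<^sup>2 / x\<^sup>2 = (t * (xi w / A\<^sup>2))\<^sup>2" by (simp only: power_mult_distrib)
  then have rho: "rho x r t = t * xi w / A\<^sup>2"
    unfolding rho_def using t xi by simp
  have "(A * (t * xi w / A\<^sup>2))\<^sup>2 - 16 * t * (t * xi w / A\<^sup>2) = (t / A)\<^sup>2 * ((xi w)\<^sup>2 - 16 * xi w)"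
    using A by (simp add: field_simps power2_eq_square)
  \<comment> \<open>The choice of the parameter \<open>w\<close> makes this radicand a perfect
    square; \<open>w > 4\<close> fixes the sign of its root.\<close>
  also have "(xi w)\<^sup>2 - 16 * xi w = (2 * w * (w - 4) / (w - 2))\<^sup>2"
    unfolding xi_def using w by (simp add: divide_simps) algebra
  finally have rad: "rad c x r t = t / A * (2 * w * (w - 4) / (w - 2))"
    unfolding rad_def rho Af_def[symmetric] A_def[symmetric] using t A w
    by (simp add: real_sqrt_mult)
  have F: "Fstar c x y r t = t * w / A"
    unfolding Fstar_eq[OF c] rho rad Af_def[symmetric] A_def[symmetric] xi_def
    using t A w by (simp add: divide_simps) algebra
  \<comment> \<open>The coefficient common to both gradient components; the
    \<open>t\<close>-component has the extra term \<open>2 \<rho> / R\<close>, which produces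
    \<open>jj\<close>.\<close>
  define k where "k = (A / rho x r t + (A\<^sup>2 - 8 * t / rho x r t) / rad c x r t) / 4"
  have Fr: "Fstar_r c x r t = r * k"
    unfolding Fstar_r_def k_def Af_def[symmetric] A_def[symmetric] by (simp add: algebra_simps diff_divide_distrib add_divide_distrib)
  have Ft: "Fstar_t c x r t = t / x\<^sup>2 * k - 2 * rho x r t / rad c x r t"
    unfolding Fstar_t_def k_def Af_def[symmetric] A_def[symmetric]
    by (simp add: algebra_simps diff_divide_distrib add_divide_distrib power2_eq_square)
  have k: "k = A^3 / (4 * t) * (1 / xi w + (1 - 8 / xi w) * (w - 2) / (2 * w * (w - 4)))"
    unfolding k_def rho rad using t A w xi by (simp add: field_simps power2_eq_square power3_eq_cube)
  have kap: "w / 4 * (1 / xi w + (1 - 8 / xi w) * (w - 2) / (2 * w * (w - 4))) = ka w"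
    unfolding xi_def ka_def using w by (simp add: divide_simps) algebra
  have Fk: "t * w / A * k = Q"
    unfolding Q_def Qf_def w_def[symmetric] A_def[symmetric] kap[symmetric] k using t A
    by (simp add: power2_eq_square power3_eq_cube)
  have Fj: "t * w / A * (2 * rho x r t / rad c x r t) = t * (jj w / A\<^sup>2)"
    unfolding rho rad jj_def xi_def using t A w by (simp add: divide_simps power2_eq_square)
  show "Fstar c x y (u / Q) (v / V) * Fstar_r c x (u / Q) (v / V) = u"
  proof -
    have "Fstar c x y r t * Fstar_r c x r t = r * (t * w / A * k)" unfolding F Fr by simp
    also have "\<dots> = u" unfolding Fk r_def using Q by simp
    finally show ?thesis unfolding r_def t_def .
  qed
  show "Fstar c x y (u / Q) (v / V) * Fstar_t c x (u / Q) (v / V) = v"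
  proof -
    have "Fstar c x y r t * Fstar_t c x r t = t / x\<^sup>2 * (t * w / A * k) - t * w / A * (2 * rho x r t / rad c x r t)"
      unfolding F Ft by (simp add: algebra_simps)
    also have "\<dots> = t * V" unfolding Fk Fj V_def Vf_def w_def[symmetric] A_def[symmetric] Q_def
      by (simp add: algebra_simps)
    also have "\<dots> = v" unfolding t_def using V by simp
    finally show ?thesis unfolding r_def t_def .
  qed
  have "Lstar c x y r t = t\<^sup>2 * (w / A)\<^sup>2 / 2"
    unfolding Lstar_def F by (simp add: power_divide power_mult_distrib)
  also have "(w / A)\<^sup>2 = V + B * Q"
    unfolding V_def B_def Q_def w_def[symmetric] A_def using V_plus_BQ[OF c x w] by simp
  also have "t\<^sup>2 * (V + B * Q) / 2 = (u\<^sup>2 / Q + v\<^sup>2 / V) / 2"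
    unfolding u2 t_def using Q V by (simp add: field_simps power2_eq_square)
  finally show "Lstar c x y (u / Q) (v / V) = (u\<^sup>2 / Q + v\<^sup>2 / V) / 2"
    unfolding r_def t_def .
qed

text \<open>\<open>Legendre_image\<close> exhibits a preimage of \<open>(u, v)\<close>, and
  \<open>Legendre_map_inj\<close> with \<open>Lstar_D4_zero\<close> makes it the only one. By
  homogeneity the pairing is twice \<open>Lstar\<close>, so half of it remains.\<close>

lemma Lleg_eq:
  assumes d: "chart_dom x u v"
  shows "Lleg c x y u v = (u\<^sup>2 / Qf c x (ww x u v) + v\<^sup>2 / Vf c x (ww x u v)) / 2"
proof -
  define r where "r = u / Qf c x (ww x u v)"
  define t where "t = v / Vf c x (ww x u v)"
  note dd = chart_domD[OF d]
  have nz: "(r, t) \<noteq> (0, 0)" using dd by (simp add: t_def)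
  have D3: "D3 (Lstar c) x y r' t' = Fstar c x y r' t' * Fstar_r c x r' t'" if "(r', t') \<noteq> (0, 0)" for r' t'
    unfolding D3_def by (rule DERIV_imp_deriv[OF Lstar_has_derivative_r[OF c dd(2) that]])
  have D4: "D4 (Lstar c) x y r' t' = Fstar c x y r' t' * Fstar_t c x r' t'" if "(r', t') \<noteq> (0, 0)" for r' t'
    unfolding D4_def by (rule DERIV_imp_deriv[OF Lstar_has_derivative_t[OF c dd(2) that]])
  note im = Legendre_image[OF d, of y, folded r_def t_def]
  have the: "(THE p. D3 (Lstar c) x y (fst p) (snd p) = u \<and> D4 (Lstar c) x y (fst p) (snd p) = v) = (r, t)"
  proof (rule the_equality)
    show "D3 (Lstar c) x y (fst (r, t)) (snd (r, t)) = u \<and> D4 (Lstar c) x y (fst (r, t)) (snd (r, t)) = v"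
      using im D3[OF nz] D4[OF nz] by simp
    fix p assume p: "D3 (Lstar c) x y (fst p) (snd p) = u \<and> D4 (Lstar c) x y (fst p) (snd p) = v"
    have nz': "(fst p, snd p) \<noteq> (0, 0)"
      using p Lstar_D4_zero[OF c dd(2), of y] dd(1) by auto
    have "fst p = r \<and> snd p = t"
      using p D3[OF nz'] D4[OF nz'] im by (intro Legendre_map_inj[OF c dd(2) nz' nz, of y]) auto
    then show "p = (r, t)" by (simp add: prod_eq_iff)
  qed
  have "Lleg c x y u v = r * u + t * v - (u\<^sup>2 / Qf c x (ww x u v) + v\<^sup>2 / Vf c x (ww x u v)) / 2"
    unfolding Lleg_def the Let_def using im(3) by simp
  then show ?thesis unfolding r_def t_def by (simp add: power2_eq_square field_simps)
qed

text \<open>Up to sign this is the \<open>w\<close>-derivative of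
  \<open>u^2 / Qf + v^2 / Vf\<close>. Its vanishing removes every derivative of \<open>ww\<close>
  from the first derivatives of \<open>Lleg\<close>, so \<open>D3\<close> and \<open>D4\<close>
  return the dual covector.\<close>

lemma stationary:
  assumes d: "chart_dom x u v"
  shows "u\<^sup>2 * Qw c x (ww x u v) / (Qf c x (ww x u v))\<^sup>2 + v\<^sup>2 * Vw c x (ww x u v) / (Vf c x (ww x u v))\<^sup>2 = 0"
  unfolding u_square[OF d] Vw_eq[OF c chart_domD(2,3)[OF d]] using chart_domD[OF d] by simp

lemma D3_Lleg:
  assumes d: "chart_dom x u v"
  shows "D3 (Lleg c) x y u v = u / Qf c x (ww x u v)"
proof (rule D3_eqI[where f = "Lleg c" and g = "\<lambda>x u v. (u\<^sup>2 / Qf c x (ww x u v) + v\<^sup>2 / Vf c x (ww x u v)) / 2", OF Lleg_eq d])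
  define Q where "Q = Qf c x (ww x u v)"
  define V where "V = Vf c x (ww x u v)"
  define e where "e = 2 * u / (v\<^sup>2 * Yw c x (ww x u v))"
  note dd = chart_domD[OF d, folded Q_def V_def]
  have "((\<lambda>s. (s\<^sup>2 / Qf c x (ww x s v) + v\<^sup>2 / Vf c x (ww x s v)) / 2) has_real_derivative
     u / Q - (u\<^sup>2 * Qw c x (ww x u v) / Q\<^sup>2 + v\<^sup>2 * Vw c x (ww x u v) / V\<^sup>2) * e / 2) (at u)"
    using dd unfolding e_def
    by (auto intro!: derivative_eq_intros chart_deriv(2)[OF d Qf_has_derivative[OF chart_domD(3)[OF d]]] chart_deriv(2)[OF d Vf_has_derivative[OF c chart_domD(2,3)[OF d]]] simp: Q_def[symmetric] V_def[symmetric] field_simps power2_eq_square)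
  then show "((\<lambda>s. (s\<^sup>2 / Qf c x (ww x s v) + v\<^sup>2 / Vf c x (ww x s v)) / 2) has_real_derivative
     u / Qf c x (ww x u v)) (at u)"
    unfolding Q_def V_def stationary[OF d] by simp
qed

lemma D4_Lleg:
  assumes d: "chart_dom x u v"
  shows "D4 (Lleg c) x y u v = v / Vf c x (ww x u v)"
proof (rule D4_eqI[where f = "Lleg c" and g = "\<lambda>x u v. (u\<^sup>2 / Qf c x (ww x u v) + v\<^sup>2 / Vf c x (ww x u v)) / 2", OF Lleg_eq d])
  define Q where "Q = Qf c x (ww x u v)"
  define V where "V = Vf c x (ww x u v)"
  define e where "e = - 2 * u\<^sup>2 / (v^3 * Yw c x (ww x u v))"
  note dd = chart_domD[OF d, folded Q_def V_def]
  have "((\<lambda>s. (u\<^sup>2 / Qf c x (ww x u s) + s\<^sup>2 / Vf c x (ww x u s)) / 2) has_real_derivative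
     v / V - (u\<^sup>2 * Qw c x (ww x u v) / Q\<^sup>2 + v\<^sup>2 * Vw c x (ww x u v) / V\<^sup>2) * e / 2) (at v)"
    using dd
    by (auto intro!: derivative_eq_intros chart_deriv(3)[OF d Qf_has_derivative[OF chart_domD(3)[OF d]], folded e_def] chart_deriv(3)[OF d Vf_has_derivative[OF c chart_domD(2,3)[OF d]], folded e_def] simp: Q_def[symmetric] V_def[symmetric])
       (simp add: field_simps power2_eq_square)
  then show "((\<lambda>s. (u\<^sup>2 / Qf c x (ww x u s) + s\<^sup>2 / Vf c x (ww x u s)) / 2) has_real_derivative
     v / Vf c x (ww x u v)) (at v)"
    unfolding Q_def V_def stationary[OF d] by simp
qed

text \<open>Only the explicit \<open>x\<close>-dependence of \<open>Qf\<close> and \<open>Vf\<close>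
  survives \<open>stationary\<close>; \<open>u_square\<close> then eliminates
  \<open>u^2\<close>.\<close>

lemma D1_Lleg:
  assumes d: "chart_dom x u v"
  defines "w \<equiv> ww x u v"
  shows "D1 (Lleg c) x y u v = - v\<^sup>2 * ((Bf c x w * Qx c x w + Vx c x w) / (2 * (Vf c x w)\<^sup>2))"
proof (rule D1_eqI[where f = "Lleg c" and g = "\<lambda>x u v. (u\<^sup>2 / Qf c x (ww x u v) + v\<^sup>2 / Vf c x (ww x u v)) / 2", OF Lleg_eq d])
  define Q where "Q = Qf c x w"
  define V where "V = Vf c x w"
  define e where "e = - Yx c x w / Yw c x w"
  note dd = chart_domD[OF d, folded w_def, folded Q_def V_def]
  have "((\<lambda>s. (u\<^sup>2 / Qf c s (ww s u v) + v\<^sup>2 / Vf c s (ww s u v)) / 2) has_real_derivative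
     - (u\<^sup>2 * Qx c x w / Q\<^sup>2 + v\<^sup>2 * Vx c x w / V\<^sup>2) / 2
     - (u\<^sup>2 * Qw c x w / Q\<^sup>2 + v\<^sup>2 * Vw c x w / V\<^sup>2) * e / 2) (at x)"
    using dd
    by (auto intro!: derivative_eq_intros chart_deriv(1)[OF d Qf_has_derivative[OF chart_domD(3)[OF d]], folded w_def, folded e_def] chart_deriv(1)[OF d Vf_has_derivative[OF c chart_domD(2,3)[OF d]], folded w_def, folded e_def] simp: Q_def[symmetric] V_def[symmetric] w_def[symmetric])
       (simp add: field_simps power2_eq_square)
  moreover have "- (u\<^sup>2 * Qx c x w / Q\<^sup>2 + v\<^sup>2 * Vx c x w / V\<^sup>2) / 2
     - (u\<^sup>2 * Qw c x w / Q\<^sup>2 + v\<^sup>2 * Vw c x w / V\<^sup>2) * e / 2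
    = - v\<^sup>2 * ((Bf c x w * Qx c x w + Vx c x w) / (2 * V\<^sup>2))"
    unfolding Q_def V_def w_def stationary[OF d] unfolding u_square[OF d]
    using chart_domD[OF d] by (simp add: field_simps)
  ultimately show "((\<lambda>s. (u\<^sup>2 / Qf c s (ww s u v) + v\<^sup>2 / Vf c s (ww s u v)) / 2) has_real_derivative
     - v\<^sup>2 * ((Bf c x w * Qx c x w + Vx c x w) / (2 * (Vf c x w)\<^sup>2))) (at x)"
    unfolding V_def by simp
qed

end

section \<open>The spray\<close>

text \<open>The part of the fibre Hessian that comes from differentiating \<open>ww\<close>: it adds
  \<open>2 Pf\<close> times the square of the covector \<open>(1, - u / v)\<close> to the diagonal
  entries \<open>1 / Qf\<close> and \<open>1 / Vf\<close>.\<close>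

definition Pf where "Pf c x w = Vf c x w * Vw c x w / (Qf c x w * Tf c x w)"

text \<open>\<open>Zf\<close> and \<open>hf\<close> are the spray coefficients \<open>G / v\<^sup>2\<close> and \<open>H / (u v)\<close>.\<close>

definition Zf where "Zf c x w = Qf c x w * (Vx c x w - Bf c x w * Qx c x w) / (4 * (Vf c x w)\<^sup>2)
   + 2 * x * w\<^sup>2 * Vw c x w / ((Af c x)^3 * Bw c x w * (Vf c x w)\<^sup>2)"

definition hf where "hf c x w = - Vx c x w / (2 * Vf c x w)
   - 2 * x * w\<^sup>2 * Vw c x w / ((Af c x)^3 * Qf c x w * Vf c x w * Bw c x w)"

text \<open>The algebra behind \<open>spray_eq\<close>, with real variables in place of the chart
  functions: the Hessian determinant, then \<open>G / v^2\<close>, then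
  \<open>H / (u v)\<close>.\<close>

lemma spray_identities:
  fixes Q V B T Bw Qx Vx Bx Vw K P X Yx Yw :: real
  assumes nz: "Q \<noteq> 0" "V \<noteq> 0" "Bw \<noteq> 0" "T \<noteq> 0"
    and T: "T = Bw * Q * V - 2 * (V + B * Q) * Vw"
    and K: "K = Vx + Bx * Q + B * Qx"
    and P: "P = V * Vw / (Q * T)" and X: "X = (B * Qx + Vx) / (2 * V\<^sup>2)"
    and Yx: "Yx = (Q / V)\<^sup>2 * (Bx + 2 * B * Qx / Q - 2 * B * Vx / V)" and Yw: "Yw = Q * T / V^3"
  shows "(1 / Q + 2 * P) * (1 / V + 2 * (B * Q\<^sup>2 / V\<^sup>2) * P) - 4 * (B * Q\<^sup>2 / V\<^sup>2) * P\<^sup>2 = Bw / T"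
    and "T / Bw * ((Vx + Vw * (- Yx / Yw)) / V^3 - (1 / V + 2 * (B * Q\<^sup>2 / V\<^sup>2) * P) * X) / 2
      = Q * (Vx - B * Qx) / (4 * V\<^sup>2) - K * Vw / (2 * Bw * V\<^sup>2)"
    and "T / Bw * (- 2 * P * X - (Vx + Vw * (- Yx / Yw)) / (V\<^sup>2 * Q)) / 2
      = - Vx / (2 * V) + K * Vw / (2 * Q * V * Bw)"
proof -
  have "(1 / Q + 2 * P) * (1 / V + 2 * (B * Q\<^sup>2 / V\<^sup>2) * P) - 4 * (B * Q\<^sup>2 / V\<^sup>2) * P\<^sup>2
      = (T + 2 * (V + B * Q) * Vw) / (Q * V * T)"
    unfolding P using nz by (simp add: field_simps power2_eq_square)
  also have "\<dots> = Bw / T" using nz by (simp add: T)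
  finally show "(1 / Q + 2 * P) * (1 / V + 2 * (B * Q\<^sup>2 / V\<^sup>2) * P) - 4 * (B * Q\<^sup>2 / V\<^sup>2) * P\<^sup>2 = Bw / T" .
  \<comment> \<open>\<open>N / T\<close> is \<open>Yx / Yw\<close>, and \<open>V * M / T\<close>
    will be the total \<open>x\<close>-derivative of \<open>V\<close> at fixed \<open>u\<close> and
    \<open>v\<close>.\<close>
  define N where "N = Q * V * Bx + 2 * B * V * Qx - 2 * B * Q * Vx"
  define M where "M = Vx * (Bw * Q - 2 * Vw) - Vw * Q * Bx - 2 * B * Vw * Qx"
  have n: "Yx / Yw = N / T"
    unfolding Yx Yw N_def using nz by (simp add: field_simps power2_eq_square power3_eq_cube)
  have "Vx + Vw * (- Yx / Yw) = Vx - Vw * (Yx / Yw)" by simp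
  also have "\<dots> = (Vx * T - Vw * N) / T" unfolding n using nz by (simp add: field_simps)
  \<comment> \<open>Inserting \<open>T\<close> makes a factor \<open>V\<close> split off, which is
    what keeps the spray coefficients short.\<close>
  also have "Vx * T - Vw * N = V * M" unfolding T N_def M_def by algebra
  finally have s1: "Vx + Vw * (- Yx / Yw) = V * M / T" .
  have "1 / V + 2 * (B * Q\<^sup>2 / V\<^sup>2) * P = (T + 2 * B * Q * Vw) / (V * T)"
    unfolding P using nz by (simp add: field_simps power2_eq_square)
  also have "T + 2 * B * Q * Vw = V * (Bw * Q - 2 * Vw)" unfolding T by algebra
  finally have s2: "1 / V + 2 * (B * Q\<^sup>2 / V\<^sup>2) * P = (Bw * Q - 2 * Vw) / T" using nz by simp
  have "T / Bw * ((Vx + Vw * (- Yx / Yw)) / V^3 - (1 / V + 2 * (B * Q\<^sup>2 / V\<^sup>2) * P) * X) / 2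
      = (2 * M - (Bw * Q - 2 * Vw) * (B * Qx + Vx)) / (4 * Bw * V\<^sup>2)"
    unfolding s1 s2 X using nz by (simp add: field_simps power2_eq_square power3_eq_cube)
  also have "2 * M - (Bw * Q - 2 * Vw) * (B * Qx + Vx) = Bw * Q * (Vx - B * Qx) - 2 * K * Vw"
    unfolding M_def K by algebra
  also have "(Bw * Q * (Vx - B * Qx) - 2 * K * Vw) / (4 * Bw * V\<^sup>2)
      = Q * (Vx - B * Qx) / (4 * V\<^sup>2) - K * Vw / (2 * Bw * V\<^sup>2)"
    using nz by (simp add: field_simps)
  finally show "T / Bw * ((Vx + Vw * (- Yx / Yw)) / V^3 - (1 / V + 2 * (B * Q\<^sup>2 / V\<^sup>2) * P) * X) / 2
      = Q * (Vx - B * Qx) / (4 * V\<^sup>2) - K * Vw / (2 * Bw * V\<^sup>2)" .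
  have "T / Bw * (- 2 * P * X - (Vx + Vw * (- Yx / Yw)) / (V\<^sup>2 * Q)) / 2
      = (- Vw * (B * Qx + Vx) - M) / (2 * Q * V * Bw)"
    unfolding s1 P X using nz by (simp add: field_simps power2_eq_square)
  also have "- Vw * (B * Qx + Vx) - M = K * Vw - Vx * Bw * Q" unfolding M_def K by algebra
  also have "(K * Vw - Vx * Bw * Q) / (2 * Q * V * Bw) = - Vx / (2 * V) + K * Vw / (2 * Q * V * Bw)"
    using nz by (simp add: field_simps)
  finally show "T / Bw * (- 2 * P * X - (Vx + Vw * (- Yx / Yw)) / (V\<^sup>2 * Q)) / 2
      = - Vx / (2 * V) + K * Vw / (2 * Q * V * Bw)" .
qed

section \<open>Rotational symmetry: the angle \<open>y\<close> is a cyclic coordinate\<close>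

lemma Lstar_indep: "Lstar c x y = Lstar c x y'"
  by (simp add: Lstar_def Fstar_def)

lemma Lleg_indep: "Lleg c x y = Lleg c x y'"
  unfolding Lleg_def D3_def D4_def Lstar_indep[of c x y y'] ..

lemma indep_D2: "(\<And>x y y'. f x y = f x y') \<Longrightarrow> D2 f = (\<lambda>x y u v. 0)"
proof (intro ext)
  fix x y u v assume "\<And>x y y'. f x y = f x y'"
  then have "(\<lambda>s. f x s u v) = (\<lambda>s. f x 0 u v)" by metis
  then show "D2 f x y u v = 0" by (simp add: D2_def)
qed

lemma indep_D:
  assumes "\<And>x y y'. f x y = f x y'"
  shows "D1 f x y = D1 f x y'" "D3 f x y = D3 f x y'" "D4 f x y = D4 f x y'"
proof -
  have *: "f x y = f x 0" for x y using assms .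
  show "D1 f x y = D1 f x y'" "D3 f x y = D3 f x y'" "D4 f x y = D4 f x y'"
    unfolding D1_def D3_def D4_def by (subst *, subst (2) *, simp)+
qed

lemma Lleg_D2: "D2 (Lleg c) = (\<lambda>x y u v. 0)" "D2 (D3 (Lleg c)) = (\<lambda>x y u v. 0)"
  using indep_D2[OF Lleg_indep] indep_D2[OF indep_D(2)[OF Lleg_indep]] .

lemma sprayG_indep: "sprayG c x y = sprayG c x y'"
  unfolding sprayG_def detL_def Lleg_D2 Let_def
    indep_D(1)[OF Lleg_indep, where x = x and y = y and y' = y'] indep_D(3)[OF Lleg_indep, where x = x and y = y and y' = y']
    indep_D(1)[OF indep_D(3)[OF Lleg_indep], where x = x and y = y and y' = y'] indep_D(3)[OF indep_D(3)[OF Lleg_indep], where x = x and y = y and y' = y']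
    indep_D(3)[OF indep_D(2)[OF Lleg_indep], where x = x and y = y and y' = y'] indep_D(2)[OF indep_D(2)[OF Lleg_indep], where x = x and y = y and y' = y']
  ..

section \<open>Second derivatives of the Lagrangian and the spray coefficients\<close>

context dual_chart
begin

lemma D33_Lleg:
  assumes d: "chart_dom x u v"
  defines "w \<equiv> ww x u v"
  shows "D3 (D3 (Lleg c)) x y u v = 1 / Qf c x w + 2 * Pf c x w"
proof (rule D3_eqI[where f = "D3 (Lleg c)" and g = "\<lambda>x u v. u / Qf c x (ww x u v)", OF D3_Lleg d])
  note dd = chart_domD[OF d, folded w_def]
  define Q where "Q = Qf c x w"
  have "((\<lambda>s. s / Qf c x (ww x s v)) has_real_derivative
      1 / Q - u * (Qw c x w * (2 * u / (v\<^sup>2 * Yw c x w))) / Q\<^sup>2) (at u)"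
    using dd
    by (auto intro!: derivative_eq_intros chart_deriv(2)[OF d Qf_has_derivative[OF chart_domD(3)[OF d]], folded w_def]
        simp: w_def[symmetric] Q_def) (simp add: field_simps power2_eq_square)
  moreover have "1 / Q - u * (Qw c x w * (2 * u / (v\<^sup>2 * Yw c x w))) / Q\<^sup>2 = 1 / Qf c x w + 2 * Pf c x w"
  proof -
    have "u * (Qw c x w * (2 * u / (v\<^sup>2 * Yw c x w))) / Q\<^sup>2 = u\<^sup>2 * (2 * Qw c x w / (v\<^sup>2 * Yw c x w * Q\<^sup>2))"
      by (simp add: power2_eq_square)
    also have "\<dots> = - 2 * Pf c x w"
      unfolding u_square[OF d, folded w_def] Pf_def Yw_def Q_def Vw_eq[OF c dd(2,3)]
      using dd by (simp add: field_simps power2_eq_square power3_eq_cube)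
    finally show ?thesis by (simp add: Q_def)
  qed
  ultimately show "((\<lambda>s. s / Qf c x (ww x s v)) has_real_derivative 1 / Qf c x w + 2 * Pf c x w) (at u)"
    by (simp only:)
qed

lemma D44_Lleg:
  assumes d: "chart_dom x u v"
  defines "w \<equiv> ww x u v"
  shows "D4 (D4 (Lleg c)) x y u v = 1 / Vf c x w + 2 * (Bf c x w * (Qf c x w)\<^sup>2 / (Vf c x w)\<^sup>2) * Pf c x w"
proof (rule D4_eqI[where f = "D4 (Lleg c)" and g = "\<lambda>x u v. v / Vf c x (ww x u v)", OF D4_Lleg d])
  note dd = chart_domD[OF d, folded w_def]
  define V where "V = Vf c x w"
  have "((\<lambda>s. s / Vf c x (ww x u s)) has_real_derivative
      1 / V - v * (Vw c x w * (- 2 * u\<^sup>2 / (v^3 * Yw c x w))) / V\<^sup>2) (at v)"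
    using dd
    by (auto intro!: derivative_eq_intros chart_deriv(3)[OF d Vf_has_derivative[OF c chart_domD(2,3)[OF d]], folded w_def]
        simp: w_def[symmetric] V_def) (simp add: field_simps power2_eq_square)
  moreover have "v * (Vw c x w * (- 2 * u\<^sup>2 / (v^3 * Yw c x w))) / V\<^sup>2
      = - 2 * (Bf c x w * (Qf c x w)\<^sup>2 / (Vf c x w)\<^sup>2) * Pf c x w"
    unfolding u_square[OF d, folded w_def] Pf_def Yw_def V_def
    using dd by (simp add: field_simps power2_eq_square power3_eq_cube)
  ultimately show "((\<lambda>s. s / Vf c x (ww x u s)) has_real_derivative
      1 / Vf c x w + 2 * (Bf c x w * (Qf c x w)\<^sup>2 / (Vf c x w)\<^sup>2) * Pf c x w) (at v)"
    by (simp add: V_def)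
qed

lemma D43_Lleg:
  assumes d: "chart_dom x u v"
  defines "w \<equiv> ww x u v"
  shows "D4 (D3 (Lleg c)) x y u v = - 2 * u / v * Pf c x w"
proof (rule D4_eqI[where f = "D3 (Lleg c)" and g = "\<lambda>x u v. u / Qf c x (ww x u v)", OF D3_Lleg d])
  note dd = chart_domD[OF d, folded w_def]
  define Q where "Q = Qf c x w"
  have "((\<lambda>s. u / Qf c x (ww x u s)) has_real_derivative
      - u * (Qw c x w * (- 2 * u\<^sup>2 / (v^3 * Yw c x w))) / Q\<^sup>2) (at v)"
    using dd
    by (auto intro!: derivative_eq_intros chart_deriv(3)[OF d Qf_has_derivative[OF chart_domD(3)[OF d]], folded w_def]
        simp: w_def[symmetric] Q_def) (simp add: field_simps power2_eq_square)
  moreover have "- u * (Qw c x w * (- 2 * u\<^sup>2 / (v^3 * Yw c x w))) / Q\<^sup>2 = - 2 * u / v * Pf c x w"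
    unfolding u_square[OF d, folded w_def] Pf_def Yw_def Q_def Vw_eq[OF c dd(2,3)]
    using dd by (simp add: field_simps power2_eq_square power3_eq_cube)
  ultimately show "((\<lambda>s. u / Qf c x (ww x u s)) has_real_derivative - 2 * u / v * Pf c x w) (at v)"
    by simp
qed

lemma D34_Lleg:
  assumes d: "chart_dom x u v"
  defines "w \<equiv> ww x u v"
  shows "D3 (D4 (Lleg c)) x y u v = - 2 * u / v * Pf c x w"
proof (rule D3_eqI[where f = "D4 (Lleg c)" and g = "\<lambda>x u v. v / Vf c x (ww x u v)", OF D4_Lleg d])
  note dd = chart_domD[OF d, folded w_def]
  define V where "V = Vf c x w"
  have "((\<lambda>s. v / Vf c x (ww x s v)) has_real_derivative
      - v * (Vw c x w * (2 * u / (v\<^sup>2 * Yw c x w))) / V\<^sup>2) (at u)"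
    using dd
    by (auto intro!: derivative_eq_intros chart_deriv(2)[OF d Vf_has_derivative[OF c chart_domD(2,3)[OF d]], folded w_def]
        simp: w_def[symmetric] V_def) (simp add: field_simps power2_eq_square)
  moreover have "- v * (Vw c x w * (2 * u / (v\<^sup>2 * Yw c x w))) / V\<^sup>2 = - 2 * u / v * Pf c x w"
    unfolding Pf_def Yw_def V_def
    using dd by (simp add: field_simps power2_eq_square power3_eq_cube)
  ultimately show "((\<lambda>s. v / Vf c x (ww x s v)) has_real_derivative - 2 * u / v * Pf c x w) (at u)"
    by simp
qed

lemma D14_Lleg:
  assumes d: "chart_dom x u v"
  defines "w \<equiv> ww x u v"
  shows "D1 (D4 (Lleg c)) x y u v = - v * (Vx c x w + Vw c x w * (- Yx c x w / Yw c x w)) / (Vf c x w)\<^sup>2"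
proof (rule D1_eqI[where f = "D4 (Lleg c)" and g = "\<lambda>x u v. v / Vf c x (ww x u v)", OF D4_Lleg d])
  note dd = chart_domD[OF d, folded w_def]
  define V where "V = Vf c x w"
  define e where "e = Vx c x w + Vw c x w * (- Yx c x w / Yw c x w)"
  have "((\<lambda>s. v / Vf c s (ww s u v)) has_real_derivative - v * e / V\<^sup>2) (at x)"
    using dd
    by (auto intro!: derivative_eq_intros chart_deriv(1)[OF d Vf_has_derivative[OF c chart_domD(2,3)[OF d]], folded w_def, folded e_def]
        simp: w_def[symmetric] V_def) (simp add: field_simps power2_eq_square)
  then show "((\<lambda>s. v / Vf c s (ww s u v)) has_real_derivative
     - v * (Vx c x w + Vw c x w * (- Yx c x w / Yw c x w)) / (Vf c x w)\<^sup>2) (at x)"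
    by (simp only: V_def e_def)
qed

text \<open>Both coefficients are 2-homogeneous in \<open>(u, v)\<close>; the reflection
  \<open>u \<mapsto> -u\<close> leaves \<open>G\<close> even and makes \<open>H\<close> odd, so
  \<open>H\<close> vanishes on \<open>u = 0\<close>.\<close>

lemma spray_eq:
  assumes d: "chart_dom x u v"
  shows "sprayG c x y u v = v\<^sup>2 * Zf c x (ww x u v)" (is ?G)
    and "sprayH c x y u v = u * v * hf c x (ww x u v)" (is ?H)
proof -
  define w where "w = ww x u v"
  note dd = chart_domD[OF d, folded w_def]
  define X where "X = (Bf c x w * Qx c x w + Vx c x w) / (2 * (Vf c x w)\<^sup>2)"
  define e where "e = Vx c x w + Vw c x w * (- Yx c x w / Yw c x w)"
  have T: "Tf c x w = Bw c x w * Qf c x w * Vf c x w - 2 * (Vf c x w + Bf c x w * Qf c x w) * Vw c x w"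
    unfolding Tf_def V_plus_BQ[OF c dd(2,3)] ..
  have nz: "Qf c x w \<noteq> 0" "Vf c x w \<noteq> 0" "Bw c x w \<noteq> 0" "Tf c x w \<noteq> 0" using dd by auto
  note id = spray_identities[OF nz T refl Pf_def X_def Yx_def Yw_def,
      unfolded Vx_plus[OF c dd(2,3)], folded e_def]
  note D = D33_Lleg[OF d, folded w_def] D44_Lleg[OF d, folded w_def] D43_Lleg[OF d, folded w_def]
    D34_Lleg[OF d, folded w_def] D14_Lleg[OF d, folded w_def, folded e_def]
    D1_Lleg[OF d, folded w_def, folded X_def] D3_Lleg[OF d, folded w_def] D4_Lleg[OF d, folded w_def]
  have "(- 2 * u / v * Pf c x w)\<^sup>2 = 4 * (Bf c x w * (Qf c x w)\<^sup>2 / (Vf c x w)\<^sup>2) * (Pf c x w)\<^sup>2"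
    using dd u_square[OF d, folded w_def] by (simp add: power_mult_distrib power_divide)
  then have det: "detL c x y u v = Bw c x w / Tf c x w"
    unfolding detL_def D by (simp only: id(1))
  have "sprayG c x y u v = v\<^sup>2 * (Tf c x w / Bw c x w * (e / (Vf c x w)^3
      - (1 / Vf c x w + 2 * (Bf c x w * (Qf c x w)\<^sup>2 / (Vf c x w)\<^sup>2) * Pf c x w) * X) / 2)"
    unfolding sprayG_def Let_def det D Lleg_D2
    using nz by (simp add: field_simps power2_eq_square power3_eq_cube)
  also have "\<dots> = v\<^sup>2 * Zf c x w"
    unfolding id(2) Zf_def by (simp add: field_simps)
  finally show ?G unfolding w_def .
  have "sprayH c x y u v = u * v * (Tf c x w / Bw c x w * (- 2 * Pf c x w * X - e / ((Vf c x w)\<^sup>2 * Qf c x w)) / 2)"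
    unfolding sprayH_def Let_def det D Lleg_D2
    using nz dd(1) by (simp add: field_simps power2_eq_square)
  also have "\<dots> = u * v * hf c x w"
    unfolding id(3) hf_def using nz by (simp add: field_simps)
  finally show ?H unfolding w_def .
qed

end

section \<open>The flag curvature on \<open>u = 0\<close>\<close>

text \<open>
  \<open>Nf\<close> is the numerator \<open>Zf Vf\<^sup>2\<close>: \<open>af\<close> is \<open>Vx - Bf Qx\<close> after eliminating \<open>xi\<close>, and \<open>x A m1 m2\<close> is the second
  summand of \<open>Zf\<close> with the common factors of \<open>Vw\<close> and \<open>Bw\<close> cancelled.
\<close>

definition m1 :: "real \<Rightarrow> real" where "m1 w = (w - 8) * (w - 2)^3 / (w - 4)^3"
definition m1' :: "real \<Rightarrow> real" where
  "m1' w = ((w - 2)^3 + 3 * (w - 8) * (w - 2)\<^sup>2) / (w - 4)^3 - 3 * (w - 8) * (w - 2)^3 / (w - 4)^4"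
definition m2 :: "real \<Rightarrow> real \<Rightarrow> real \<Rightarrow> real" where
  "m2 c x w = (Af c x)\<^sup>2 / (8 * x\<^sup>2) * ((w - 2)\<^sup>2 / w^4) - 1 / (2 * (Af c x)\<^sup>2)"
definition m2' :: "real \<Rightarrow> real \<Rightarrow> real \<Rightarrow> real" where
  "m2' c x w = (Af c x)\<^sup>2 / (8 * x\<^sup>2) * (2 * (w - 2) / w^4 - 4 * (w - 2)\<^sup>2 / w^5)"
definition af :: "real \<Rightarrow> real \<Rightarrow> real \<Rightarrow> real" where
  "af c x w = (8 * Af c x / x - 2 * (Af c x)\<^sup>2 / x^3) * ka w - 4 * x * w\<^sup>2 / (Af c x)^3"
definition af' :: "real \<Rightarrow> real \<Rightarrow> real \<Rightarrow> real" where
  "af' c x w = (8 * Af c x / x - 2 * (Af c x)\<^sup>2 / x^3) * ka' w - 8 * x * w / (Af c x)^3"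
definition Nf where "Nf c x w = Qf c x w * af c x w / 4 + x * Af c x * m1 w * m2 c x w"
definition Nw where "Nw c x w = (Qw c x w * af c x w + Qf c x w * af' c x w) / 4
   + x * Af c x * (m1' w * m2 c x w + m1 w * m2' c x w)"
definition Zw where "Zw c x w = Nw c x w / (Vf c x w)\<^sup>2 - 2 * Nf c x w * Vw c x w / (Vf c x w)^3"

text \<open>Dividing \<open>Vw\<close> by \<open>Bw\<close> amounts to dividing \<open>ka'\<close>
  and \<open>jj'\<close> by \<open>xi * xi'\<close>, and both quotients contain \<open>m1\<close>.
  This clears \<open>Bw\<close> from the denominator before differentiating in
  \<open>w\<close>.\<close>

lemma Zf_eq:
  assumes "c > 3/2" "x > 0" "w > 4" "Vf c x w > 0"
  shows "Zf c x w = Nf c x w / (Vf c x w)\<^sup>2"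
proof -
  define A where "A = Af c x"
  have A: "A > 0" unfolding A_def using assms by (simp add: Af_pos)
  have B: "Bw c x w > 0" using assms by (simp add: Bw_pos)
  have "Vx c x w - Bf c x w * Qx c x w
      = (8 * A / x - 2 * A\<^sup>2 / x^3) * ka w - 4 * x * ((xi w)\<^sup>2 * ka w - jj w) / A^3"
    unfolding Vx_def Bf_def Qf_def Qx_def A_def[symmetric] using A assms(2)
    by (simp add: field_simps power2_eq_square power3_eq_cube power4_eq_xxxx)
  then have a: "Vx c x w - Bf c x w * Qx c x w = af c x w"
    unfolding af_def A_def using xi_ka[OF assms(3)] by simp
  have xx: "xi w * xi' w = 4 * w^3 * (w - 4) / (w - 2)^3"
    unfolding xi_def xi'_def using assms by (simp add: field_simps power2_eq_square power3_eq_cube)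
  have "2 * x * w\<^sup>2 * Vw c x w / (A^3 * Bw c x w)
     = x * A * w\<^sup>2 * (A\<^sup>2 * (ka' w / (xi w * xi' w)) / x\<^sup>2 - (jj' w / (xi w * xi' w)) / A\<^sup>2)"
    unfolding Vw_def Bw_def Qw_def A_def[symmetric] using A assms xi_pos[OF assms(3)] xi'_pos[OF assms(3)]
    by (simp add: field_simps power2_eq_square power3_eq_cube power4_eq_xxxx)
  also have "ka' w / (xi w * xi' w) = m1 w * (w - 2)\<^sup>2 / (8 * w^6)"
    unfolding xx ka'_def m1_def using assms by (simp add: divide_simps) (simp add: numeral_eq_Suc)
  also have "jj' w / (xi w * xi' w) = m1 w / (2 * w\<^sup>2)"
    unfolding xx jj'_def m1_def using assms by (simp add: divide_simps) (simp add: numeral_eq_Suc)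
  also have "x * A * w\<^sup>2 * (A\<^sup>2 * (m1 w * (w - 2)\<^sup>2 / (8 * w^6)) / x\<^sup>2 - m1 w / (2 * w\<^sup>2) / A\<^sup>2)
      = x * A * m1 w * (w\<^sup>2 * (A\<^sup>2 * ((w - 2)\<^sup>2 / (8 * w^6)) / x\<^sup>2 - 1 / (2 * w\<^sup>2) / A\<^sup>2))"
    by (simp add: algebra_simps)
  also have "w\<^sup>2 * (A\<^sup>2 * ((w - 2)\<^sup>2 / (8 * w^6)) / x\<^sup>2 - 1 / (2 * w\<^sup>2) / A\<^sup>2) = m2 c x w"
    unfolding m2_def A_def[symmetric] using assms A by (simp add: field_simps)
  finally have b: "2 * x * w\<^sup>2 * Vw c x w / (A^3 * Bw c x w) = x * A * m1 w * m2 c x w" .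
  have "Zf c x w = (Qf c x w * af c x w / 4 + 2 * x * w\<^sup>2 * Vw c x w / (A^3 * Bw c x w)) / (Vf c x w)\<^sup>2"
    unfolding Zf_def a A_def by (simp add: add_divide_distrib)
  then show ?thesis using b unfolding Nf_def A_def by simp
qed

lemma Nf_deriv:
  assumes "c > 3/2" "x > 0" "w > 4"
  shows "(Nf c x has_real_derivative Nw c x w) (at w)"
proof -
  have A: "Af c x > 0" using assms by (simp add: Af_pos)
  have q: "(Qf c x has_real_derivative Qw c x w) (at w)"
    unfolding Qf_def[abs_def] Qw_def by (auto intro!: derivative_eq_intros ka_deriv assms)
  have a: "(af c x has_real_derivative af' c x w) (at w)"
    unfolding af_def[abs_def] af'_def using A assms
    by (auto intro!: derivative_eq_intros ka_deriv) (simp add: field_simps numeral_eq_Suc)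
  have 1: "(m1 has_real_derivative m1' w) (at w)"
    unfolding m1_def[abs_def] m1'_def using assms
    by (auto intro!: derivative_eq_intros simp: divide_simps) algebra
  have 2: "(m2 c x has_real_derivative m2' c x w) (at w)"
  proof -
    have "((\<lambda>w. (w - 2)\<^sup>2 / w^4) has_real_derivative 2 * (w - 2) / w^4 - 4 * (w - 2)\<^sup>2 / w^5) (at w)"
      using assms by (auto intro!: derivative_eq_intros simp: divide_simps) (simp add: numeral_eq_Suc algebra_simps)
    from DERIV_diff[OF DERIV_cmult[OF this, of "(Af c x)\<^sup>2 / (8 * x\<^sup>2)"] DERIV_const[of "1 / (2 * (Af c x)\<^sup>2)"]]
    show ?thesis unfolding m2_def[abs_def] m2'_def by (simp only: diff_0_right)
  qed
  show ?thesis unfolding Nf_def[abs_def] Nw_def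
    by (auto intro!: derivative_eq_intros q a 1 2 simp: field_simps)
qed

lemma Vf_deriv:
  assumes "c > 3/2" "x > 0" "w > 4"
  shows "(Vf c x has_real_derivative Vw c x w) (at w)"
  using has_derivative_along_curve[where g = "\<lambda>_. x" and k = "\<lambda>w. w", OF Vf_has_derivative[OF assms], of 0 1]
  by simp

lemma continuous_chart_functions:
  assumes "c > 3/2" "x > 0" "w > 4" "Vf c x w > 0"
  shows "isCont (Vf c x) w" "isCont (Qf c x) w" "isCont (Vw c x) w" "isCont (Vx c x) w" "isCont (Bw c x) w"
    "isCont (Nw c x) w" "isCont (Nf c x) w"
proof -
  have A: "Af c x > 0" using assms by (simp add: Af_pos)
  have k: "isCont ka w" "isCont jj w" "isCont xi w"
    using ka_deriv jj_deriv xi_deriv assms(3) DERIV_isCont by blast+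
  have k': "isCont ka' w" "isCont jj' w" "isCont xi' w"
    unfolding ka'_def[abs_def] jj'_def[abs_def] xi'_def[abs_def] using assms
    by (auto intro!: continuous_intros)
  show "isCont (Vf c x) w" using Vf_deriv[OF assms(1-3)] by (rule DERIV_isCont)
  show N: "isCont (Nf c x) w" using Nf_deriv[OF assms(1-3)] by (rule DERIV_isCont)
  show Q: "isCont (Qf c x) w" unfolding Qf_def[abs_def] by (intro continuous_intros k)
  show "isCont (Vw c x) w" unfolding Vw_def[abs_def] Qw_def[abs_def] using A assms
    by (intro continuous_intros k') auto
  show "isCont (Vx c x) w" unfolding Vx_def[abs_def] Qx_def[abs_def] using A assms
    by (intro continuous_intros k Q) auto
  show "isCont (Bw c x) w" unfolding Bw_def[abs_def] using A assms
    by (intro continuous_intros k k') auto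
  have "isCont (Qw c x) w" unfolding Qw_def[abs_def] by (intro continuous_intros k')
  moreover have "isCont (af c x) w" unfolding af_def[abs_def] using A assms
    by (intro continuous_intros k) auto
  moreover have "isCont (af' c x) w" unfolding af'_def[abs_def] using A assms
    by (intro continuous_intros k') auto
  moreover have "isCont m1 w" "isCont m1' w" unfolding m1_def[abs_def] m1'_def[abs_def] using assms
    by (auto intro!: continuous_intros)
  moreover have "isCont (m2 c x) w" "isCont (m2' c x) w" unfolding m2_def[abs_def] m2'_def[abs_def] using A assms
    by (auto intro!: continuous_intros)
  ultimately show "isCont (Nw c x) w" unfolding Nw_def[abs_def] using Q
    by (intro continuous_intros) auto
qed

lemma Zf_deriv:
  assumes "c > 3/2" "x > 0" "w > 4" "Vf c x w > 0"
  shows "(Zf c x has_real_derivative Zw c x w) (at w)"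
proof -
  have der: "((\<lambda>w. Nf c x w / (Vf c x w)\<^sup>2) has_real_derivative Zw c x w) (at w)"
    unfolding Zw_def using assms(4)
    by (auto intro!: derivative_eq_intros Nf_deriv[OF assms(1-3)] Vf_deriv[OF assms(1-3)]
      simp: divide_simps) (simp add: power2_eq_square power3_eq_cube power4_eq_xxxx algebra_simps numeral_eq_Suc)
  have V: "(Vf c x \<longlongrightarrow> Vf c x w) (nhds w)"
    using continuous_chart_functions(1)[OF assms] by (simp add: isCont_def tendsto_nhds_iff)
  have "eventually (\<lambda>w. w > 4 \<and> Vf c x w > 0) (nhds w)"
    using order_tendstoD(1)[OF filterlim_ident assms(3)] order_tendstoD(1)[OF V assms(4)]
    by eventually_elim simp
  then have ev: "eventually (\<lambda>w. Zf c x w = Nf c x w / (Vf c x w)\<^sup>2) (nhds w)"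
    by eventually_elim (use Zf_eq assms in blast)
  show ?thesis by (rule DERIV_cong_ev[OF refl ev refl, THEN iffD2, OF der])
qed

text \<open>On \<open>u = 0\<close> the functions \<open>G_u\<close> and \<open>H\<close> carry an
  explicit factor \<open>u\<close>, so their \<open>u\<close>-derivatives there need only continuity
  of the cofactor.\<close>

lemma DERIV_mult_isCont_zero:
  fixes q :: "real \<Rightarrow> real"
  assumes "isCont q 0"
  shows "((\<lambda>s. s * q s) has_real_derivative q 0) (at 0)"
  unfolding DERIV_def
proof -
  have "(q \<longlongrightarrow> q 0) (at 0)" using assms by (simp add: isCont_def)
  moreover have "eventually (\<lambda>h. ((0 + h) * q (0 + h) - 0 * q 0) / h = q h) (at 0)"
    by (auto simp: eventually_at intro: exI[of _ 1])
  ultimately show "((\<lambda>h. ((0 + h) * q (0 + h) - 0 * q 0) / h) \<longlongrightarrow> q 0) (at 0)"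
    by (simp add: tendsto_cong)
qed

context dual_chart
begin

lemma ww_zero: "ww x 0 v = W x 0"
  by (simp add: ww_def)

lemma D3_sprayG:
  assumes d: "chart_dom x u v"
  shows "D3 (sprayG c) x y u v = u * (2 * Zw c x (ww x u v) / Yw c x (ww x u v))"
proof (rule D3_eqI[where f = "sprayG c" and g = "\<lambda>x u v. v\<^sup>2 * Zf c x (ww x u v)", OF spray_eq(1) d])
  note dd = chart_domD[OF d]
  have "((\<lambda>s. Zf c x (ww x s v)) has_real_derivative Zw c x (ww x u v) * (2 * u / (v\<^sup>2 * Yw c x (ww x u v)))) (at u)"
    by (rule DERIV_chain2[OF Zf_deriv[OF c dd(2-4)] ww_deriv_u[OF d]])
  from DERIV_cmult[OF this, of "v\<^sup>2"]
  show "((\<lambda>s. v\<^sup>2 * Zf c x (ww x s v)) has_real_derivative u * (2 * Zw c x (ww x u v) / Yw c x (ww x u v))) (at u)"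
    using dd(1) by (simp add: mult.commute mult.left_commute)
qed

text \<open>On \<open>u = 0\<close> both \<open>H\<close> and \<open>G_u\<close> vanish, and
  \<open>G_yu\<close> vanishes by symmetry. What remains is \<open>G_xv\<close>,
  \<open>G G_uu\<close> and \<open>G_v H_u\<close>, divided by
  \<open>v L_v = v^2 / Vf\<close>.\<close>

lemma flagK_at_zero:
  assumes d: "chart_dom x 0 v" and d1: "((\<lambda>s. Zf c s (W s 0)) has_real_derivative d1) (at x)"
  defines "w \<equiv> W x 0"
  shows "flagK c x y 0 v = Vf c x w * (2 * d1 + 4 * Zf c x w * Zw c x w / Yw c x w - 2 * Zf c x w * hf c x w)"
proof -
  note dd = chart_domD[OF d, unfolded ww_zero, folded w_def]
  \<comment> \<open>For \<open>u = 0\<close> the ratio \<open>u^2 / v^2\<close> is zero for every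
    \<open>v\<close>, so the parameter does not vary with \<open>v\<close>.\<close>
  have w0: "ww x 0 v = w" for v by (simp add: ww_zero w_def)
  have cw: "isCont (\<lambda>s. ww x s v) 0" using ww_deriv_u[OF d] by (rule DERIV_isCont)
  note cc = continuous_chart_functions[OF c dd(2-4)]
  have ccw: "isCont (\<lambda>s. f (ww x s v)) 0" if "isCont f w" for f :: "real \<Rightarrow> real"
    using isCont_o2[OF cw, of f] that by (simp add: w0)
  have G: "sprayG c x y 0 v = v\<^sup>2 * Zf c x w" using spray_eq(1)[OF d] by (simp add: w0)
  have H: "sprayH c x y 0 v = 0" using spray_eq(2)[OF d] by simp
  have D3G: "D3 (sprayG c) x y 0 v = 0" using D3_sprayG[OF d] by simp
  have D1G: "D1 (sprayG c) x y 0 s = s\<^sup>2 * d1" if "chart_dom x 0 s" for s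
  proof (rule D1_eqI[where f = "sprayG c" and g = "\<lambda>x u v. v\<^sup>2 * Zf c x (ww x u v)", OF spray_eq(1) that])
    show "((\<lambda>r. s\<^sup>2 * Zf c r (ww r 0 s)) has_real_derivative s\<^sup>2 * d1) (at x)"
      unfolding ww_zero by (rule DERIV_cmult[OF d1])
  qed
  have "deriv (\<lambda>s. D1 (sprayG c) x y 0 s) v = deriv (\<lambda>s. s\<^sup>2 * d1) v"
    by (rule deriv_cong_ev[OF eventually_mono[OF eventually_chart_dom(3)[OF d]] refl]) (rule D1G)
  also have "\<dots> = 2 * v * d1"
    by (rule DERIV_imp_deriv) (auto intro!: derivative_eq_intros)
  finally have D41G: "D4 (D1 (sprayG c)) x y 0 v = 2 * v * d1" unfolding D4_def .
  have D32G: "D3 (D2 (sprayG c)) x y 0 v = 0"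
    unfolding indep_D2[OF sprayG_indep] D3_def by simp
  have "isCont (\<lambda>s. 2 * Zw c x (ww x s v) / Yw c x (ww x s v)) 0"
    unfolding Zw_def Yw_def Tf_def using dd
    by (intro continuous_intros ccw cc) (auto simp: w0 Tf_def)
  from DERIV_mult_isCont_zero[OF this]
  have D33G: "D3 (D3 (sprayG c)) x y 0 v = 2 * Zw c x w / Yw c x w"
    by (intro D3_eqI[where f = "D3 (sprayG c)" and
         g = "\<lambda>x u v. u * (2 * Zw c x (ww x u v) / Yw c x (ww x u v))", OF D3_sprayG d])
       (simp_all add: w0)
  have D4G: "D4 (sprayG c) x y 0 v = 2 * v * Zf c x w"
  proof (rule D4_eqI[where f = "sprayG c" and g = "\<lambda>x u v. v\<^sup>2 * Zf c x (ww x u v)", OF spray_eq(1) d])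
    show "((\<lambda>s. s\<^sup>2 * Zf c x (ww x 0 s)) has_real_derivative 2 * v * Zf c x w) (at v)"
      unfolding w0 by (auto intro!: derivative_eq_intros)
  qed
  have "isCont (\<lambda>s. v * hf c x (ww x s v)) 0"
    unfolding hf_def using dd by (intro continuous_intros ccw cc) (auto simp: w0)
  from DERIV_mult_isCont_zero[OF this]
  have D3H: "D3 (sprayH c) x y 0 v = v * hf c x w"
    by (intro D3_eqI[where f = "sprayH c" and g = "\<lambda>x u v. u * v * hf c x (ww x u v)", OF spray_eq(2) d])
       (simp_all add: w0 mult.assoc)
  have D4L: "D4 (Lleg c) x y 0 v = v / Vf c x w" using D4_Lleg[OF d] by (simp add: w0)
  show ?thesis
    unfolding flagK_def Let_def D41G D32G D33G D3G D4G D3H D4L G H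
    using dd by (simp add: field_simps power2_eq_square)
qed

end

section \<open>Existence of a chart around an admissible point\<close>

lemma continuous_on_chart_functions:
  assumes "c > 3/2"
  shows "continuous_on {p. fst p > 0 \<and> snd p > 4} (\<lambda>p. Vf c (fst p) (snd p))"
    and "continuous_on {p. fst p > 0 \<and> snd p > 4} (\<lambda>p. Tf c (fst p) (snd p))"
proof -
  have A: "Af c x \<noteq> 0" for x using Af_pos[OF assms, of x] by simp
  have Ac: "continuous_on S (\<lambda>p. Af c (fst p))" for S :: "(real \<times> real) set"
    unfolding Af_def by (intro continuous_intros)
  show "continuous_on {p. fst p > 0 \<and> snd p > 4} (\<lambda>p. Vf c (fst p) (snd p))"
    unfolding Vf_def Qf_def ka_def jj_def by (intro continuous_intros Ac) (auto simp: A)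
  then show "continuous_on {p. fst p > 0 \<and> snd p > 4} (\<lambda>p. Tf c (fst p) (snd p))"
    unfolding Tf_def Bw_def Qf_def Vw_def Qw_def ka_def ka'_def jj'_def xi_def xi'_def
    by (intro continuous_intros Ac) (auto simp: A)
qed

text \<open>Positivity of \<open>Vf\<close> and \<open>Tf\<close> is an open condition and gives
  \<open>Yw > 0\<close>, so the implicit function lemma applies around
  \<open>(x0, w0)\<close>.\<close>

lemma dual_chart_exists:
  assumes c: "c > 3/2" and p: "x0 > 0" "w0 > 4" "Vf c x0 w0 > 0" "Tf c x0 w0 > 0"
  obtains U W where "dual_chart c U W" "(x0, Yf c x0 w0) \<in> U" "W x0 (Yf c x0 w0) = w0"
proof -
  define S0 :: "(real \<times> real) set" where "S0 = {p. fst p > 0 \<and> snd p > 4}"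
  have S0: "open S0" unfolding S0_def
    by (intro open_Collect_conj open_Collect_less continuous_intros)
  define S where "S = (S0 \<inter> (\<lambda>p. Vf c (fst p) (snd p)) -` {0<..}) \<inter> (S0 \<inter> (\<lambda>p. Tf c (fst p) (snd p)) -` {0<..})"
  have S: "open S" unfolding S_def S0_def
    by (intro open_Int continuous_open_preimage continuous_on_chart_functions c S0[unfolded S0_def]) auto
  have iff: "(x, w) \<in> S \<longleftrightarrow> x > 0 \<and> w > 4 \<and> Vf c x w > 0 \<and> Tf c x w > 0" for x w
    by (auto simp: S_def S0_def)
  have mem: "(x0, w0) \<in> S" using p by (simp add: iff)
  have der: "((\<lambda>p. Yf c (fst p) (snd p)) has_derivative (\<lambda>h. Yx c x w * fst h + Yw c x w * snd h)) (at (x, w))"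
    if "(x, w) \<in> S" for x w using Yf_has_derivative[OF c] that by (simp add: iff)
  have pos: "Yw c x w > 0" if "(x, w) \<in> S" for x w
    using that Qf_pos[OF c, of w x] by (simp add: iff Yw_def)
  show ?thesis
  proof (rule implicit_function_of_partial_pos[OF S mem der pos])
    fix U W assume UW: "open U" "(x0, Yf c x0 w0) \<in> U" "W x0 (Yf c x0 w0) = w0"
      and W: "\<And>x n. (x, n) \<in> U \<Longrightarrow> (x, W x n) \<in> S \<and> Yf c x (W x n) = n"
      and W': "\<And>x n. (x, n) \<in> U \<Longrightarrow> ((\<lambda>p. W (fst p) (snd p)) has_derivative
        (\<lambda>h. - Yx c x (W x n) / Yw c x (W x n) * fst h + 1 / Yw c x (W x n) * snd h)) (at (x, n))"
    have "dual_chart c U W"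
    proof
      show "c > 3/2" "open U" by fact+
      show "x > 0 \<and> W x n > 4 \<and> Vf c x (W x n) > 0 \<and> Tf c x (W x n) > 0 \<and> Yf c x (W x n) = n"
        if "(x, n) \<in> U" for x n using W[OF that] by (simp add: iff)
    qed (rule W')
    then show ?thesis using UW(2,3) by (rule that)
  qed
qed

section \<open>Evaluation at a rational point of negative curvature\<close>

theorem theoremB:
  shows "\<exists>c x y u v :: real. c > 3/2 \<and> x > 0 \<and> (u, v) \<noteq> (0, 0) \<and> v \<noteq> 0
            \<and> flagK c x y u v < 0"
proof -
  define c :: real where "c = 61/40"
  define x :: real where "x = 1/2"
  \<comment> \<open>The value of \<open>A Fstar / t\<close> at \<open>r = 0\<close>, namely
    \<open>A * (A + sqrt (A^2 - 16 * x)) / (4 * x)\<close> with \<open>A = 33/10\<close> and root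
    \<open>17/10\<close>.\<close>
  define w :: real where "w = 33/4"
  have c: "c > 3/2" by (simp add: c_def)
  have A: "Af c x = 33/10" by (simp add: Af_def c_def x_def power2_eq_square)
  have ka: "ka w = 15625/74052" and jj: "jj w = 1089/34" and xi: "xi w = 1089/50"
    by (simp_all add: ka_def jj_def xi_def w_def power2_eq_square power3_eq_cube)
  have Q: "Qf c x w = 625/272" unfolding Qf_def A ka by (simp add: power2_eq_square)
  have Qx: "Qx c x w = 3125/2244" unfolding Qx_def A ka by (simp add: x_def)
  have Qw: "Qw c x w = 50/9537" unfolding Qw_def A ka'_def by (simp add: w_def power2_eq_square power3_eq_cube)
  have V: "Vf c x w = 25/4" unfolding Vf_def Q jj A by (simp add: x_def power2_eq_square)
  have Vx: "Vx c x w = - 500/17" unfolding Vx_def Qx Q jj A by (simp add: x_def power2_eq_square power3_eq_cube)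
  have Vw: "Vw c x w = 0" unfolding Vw_def Qw jj'_def A by (simp add: x_def w_def power2_eq_square)
  have B: "Bf c x w = 0" unfolding Bf_def xi A by (simp add: x_def power2_eq_square power4_eq_xxxx)
  have Bx: "Bx c x w = 368/33"
    unfolding Bx_def xi A by (simp add: x_def power2_eq_square power3_eq_cube numeral_eq_Suc)
  have Bw: "Bw c x w = 544/825" unfolding Bw_def xi xi'_def A by (simp add: w_def power2_eq_square power4_eq_xxxx)
  have T: "Tf c x w = 625/66" unfolding Tf_def Bw Q V Vw by simp
  have Yx: "Yx c x w = 14375/9537" unfolding Yx_def Q V Bx B by (simp add: power2_eq_square)
  have Yw: "Yw c x w = 50/561" unfolding Yw_def Q T V by (simp add: power3_eq_cube)
  have Y: "Yf c x w = 0" unfolding Yf_def B by simp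
  have h: "hf c x w = 40/17" unfolding hf_def Vx V Vw by simp
  have Z: "Zf c x w = - 125/289" unfolding Zf_def Q Vx B V Vw by (simp add: power2_eq_square)
  have Zw: "Zw c x w = - 230/14739"
    unfolding Zw_def Nw_def Vw V Q Qw A af_def af'_def ka ka'_def m1_def m1'_def m2_def m2'_def by (simp add: x_def w_def power2_eq_square power3_eq_cube numeral_eq_Suc)
  obtain U W where ch: "dual_chart c U W" and x0U: "(x, 0) \<in> U" and W: "W x 0 = w"
    using dual_chart_exists[OF c, of x w] by (auto simp: Y V T) (auto simp: x_def w_def)
  interpret dual_chart c U W by (rule ch)
  have d: "chart_dom x 0 1" using x0U by (simp add: chart_dom_def)
  have wx: "((\<lambda>s. W s 0) has_real_derivative - 575/34) (at x)"
    using ww_deriv_x[OF d] by (simp add: ww_zero W Yx Yw)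
  have d1: "((\<lambda>s. Zf c s (W s 0)) has_real_derivative - 249875/167042) (at x)"
  proof -
    \<comment> \<open>Along the curve \<open>u = 0\<close> the function \<open>Bf\<close> stays
      zero, hence so does \<open>Vw\<close>. The second summand of \<open>Zf\<close> drops out, and
      no derivative of \<open>Bw\<close> or \<open>Vw\<close> is required.\<close>
    have Bz: "Bf c s (W s 0) = 0" if "chart_dom s 0 1" for s
      using chart_domD[OF that] by (simp add: Yf_def ww_zero)
    have eq: "Zf c s (W s 0) = Qf c s (W s 0) * Vx c s (W s 0) / (4 * (Vf c s (W s 0))\<^sup>2)" if "chart_dom s 0 1" for s
      using Vw_eq[OF c chart_domD(2,3)[OF that]] Bz[OF that] by (simp add: Zf_def ww_zero)
    have ka_d: "((\<lambda>s. ka (W s 0)) has_real_derivative ka' w * (- 575/34)) (at x)"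
      by (rule DERIV_chain2[OF _ wx]) (simp add: W ka_deriv w_def)
    have jj_d: "((\<lambda>s. jj (W s 0)) has_real_derivative jj' w * (- 575/34)) (at x)"
      by (rule DERIV_chain2[OF _ wx]) (simp add: W jj_deriv w_def)
    have A_d: "((\<lambda>s. Af c s) has_real_derivative 1) (at x)"
      unfolding Af_def by (auto intro!: derivative_eq_intros simp: x_def)
    have Q_d: "((\<lambda>s. Qf c s (W s 0)) has_real_derivative 25625/19652) (at x)"
      unfolding Qf_def
      by (rule derivative_eq_intros A_d ka_d refl)+
        (unfold A W ka ka'_def, simp add: w_def power2_eq_square power3_eq_cube)
    have Qx_d: "((\<lambda>s. Qx c s (W s 0)) has_real_derivative 4 * (33/10) * (15625/74052) + 2 * (15625/74052) + 33/5 * (ka' w * (- 575/34))) (at x)"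
      unfolding Qx_def
      by (rule derivative_eq_intros A_d ka_d refl)+
        (unfold A W ka, simp add: x_def)
    \<comment> \<open>Because \<open>Vw\<close> is zero at this point, the slope of \<open>W\<close>
      does not contribute and the total derivative equals \<open>Vx\<close>.\<close>
    have V_d: "((\<lambda>s. Vf c s (W s 0)) has_real_derivative - 500/17) (at x)"
      using has_derivative_along_curve[where g = "\<lambda>s. s" and k = "\<lambda>s. W s 0", OF Vf_has_derivative[OF c, of x w, folded W] _ wx, of 1]
      by (simp add: W Vx Vw) (simp add: x_def w_def)
    have Vx_d: "((\<lambda>s. Vx c s (W s 0)) has_real_derivative 942250/4913) (at x)"
      unfolding Vx_def
      by ((rule derivative_eq_intros A_d Q_d Qx_d jj_d refl | (simp add: A; fail) | (simp add: x_def; fail))+, unfold A W Q Qx jj jj'_def ka'_def, simp add: x_def w_def power2_eq_square power3_eq_cube numeral_eq_Suc)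
    have der: "((\<lambda>s. Qf c s (W s 0) * Vx c s (W s 0) / (4 * (Vf c s (W s 0))\<^sup>2)) has_real_derivative - 249875/167042) (at x)"
      by ((rule derivative_eq_intros Q_d Vx_d V_d refl | (simp add: W V; fail))+, unfold W Q Vx V, simp add: power2_eq_square)
    have ev: "eventually (\<lambda>s. Zf c s (W s 0) = Qf c s (W s 0) * Vx c s (W s 0) / (4 * (Vf c s (W s 0))\<^sup>2)) (nhds x)"
      using eventually_chart_dom(1)[OF d] by eventually_elim (rule eq)
    show ?thesis by (rule DERIV_cong_ev[OF refl ev refl, THEN iffD2, OF der])
  qed
  have "flagK c x 0 0 1 = - 1364375/334084"
    unfolding flagK_at_zero[OF d d1] W V Z Zw Yw h by simp
  then show ?thesis using c by (intro exI[of _ c] exI[of _ x] exI[of _ 0] exI[of _ 1]) (simp add: x_def)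
qed

end
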